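(* For every neighborhood $V$ of the identity map of $[0,1]$ in $\mathrm{Diff}_+^1([0,1])$ with respect to the $C^1$-topology, there exists an injective group homomorphism $H\hookrightarrow \mathrm{Diff}_+^1([0,1])$ sending the canonical generators $\mathtt a,\mathtt b,\mathtt c,\mathtt d$ of $H$ into $V$.
   Context: $\mathrm{Diff}_+^1([0,1])$ is the group of orientation preserving $C^1$ diffeomorphisms of $[0,1]$. $H$ is the group of bijections of the set $\mathbb{Z}^{\mathbb{N}}$ of sequences $(l_1,l_2,l_3,\ldots)$ of integers generated by the four elements $\mathtt a,\mathtt b,\mathtt c,\mathtt d$ defined recursively as follows, with the convention $(l_1,(l_2,l_3,\ldots))=(l_1,l_2,l_3,\ldots)$: $$\mathtt a(l_1,l_2,l_3,\ldots)=(1+l_1,l_2,l_3,\ldots),$$ $\mathtt b(l_1,l_2,\ldots)=(l_1,\mathtt a(l_2,l_3,\ldots))$ if $l_1$ is even and $(l_1,\mathtt c(l_2,l_3,\ldots))$ if $l_1$ is odd; $\mathtt c(l_1,l_2,\ldots)=(l_1,\mathtt a(l_2,l_3,\ldots))$ if $l_1$ is even and $(l_1,\mathtt d(l_2,l_3,\ldots))$ if $l_1$ is odd; $\mathtt d(l_1,l_2,\ldots)=(l_1,l_2,l_3,\ldots)$ if $l_1$ is even and $(l_1,\mathtt b(l_2,l_3,\ldots))$ if $l_1$ is odd. *)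

theory Defs
  imports "HOL-Analysis.Analysis" "HOL-Algebra.Bij" "HOL-Algebra.Generated_Groups"
begin

section \<open>The group H\<close>

text \<open>A sequence $(l_1, l_2, \dots)$ of integers is a function \<open>l :: nat \<Rightarrow> int\<close> with
  $l_1 = l(0)$.\<close>

definition seq_cons :: "int \<Rightarrow> (nat \<Rightarrow> int) \<Rightarrow> nat \<Rightarrow> int"
  where "seq_cons m l = case_nat m l"

definition seq_tl :: "(nat \<Rightarrow> int) \<Rightarrow> nat \<Rightarrow> int"
  where "seq_tl l = (\<lambda>n. l (Suc n))"

definition gen_a :: "(nat \<Rightarrow> int) \<Rightarrow> nat \<Rightarrow> int"
  where "gen_a l = seq_cons (1 + l 0) (seq_tl l)"

text \<open>The simultaneous recursion terminates entry by entry; the defining equations on whole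
  sequences are \<open>gen_b_eq\<close>, \<open>gen_c_eq\<close> and \<open>gen_d_eq\<close> below.\<close>

fun gen_b gen_c gen_d :: "(nat \<Rightarrow> int) \<Rightarrow> nat \<Rightarrow> int"
  where
    "gen_b l 0 = l 0"
  | "gen_b l (Suc n) = (if even (l 0) then gen_a (seq_tl l) n else gen_c (seq_tl l) n)"
  | "gen_c l 0 = l 0"
  | "gen_c l (Suc n) = (if even (l 0) then gen_a (seq_tl l) n else gen_d (seq_tl l) n)"
  | "gen_d l 0 = l 0"
  | "gen_d l (Suc n) = (if even (l 0) then seq_tl l n else gen_b (seq_tl l) n)"

lemma seq_cons_simps [simp]: "seq_cons m l 0 = m" "seq_cons m l (Suc n) = l n"
  by (simp_all add: seq_cons_def)

lemma seq_tl_cons [simp]: "seq_tl (seq_cons m l) = l"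
  by (simp add: seq_tl_def)

lemma seq_cons_tl: "seq_cons (l 0) (seq_tl l) = l"
  by (rule ext, case_tac x) (simp_all add: seq_tl_def)

lemma gen_b_eq:
  "gen_b l = seq_cons (l 0) (if even (l 0) then gen_a (seq_tl l) else gen_c (seq_tl l))"
  by (rule ext, case_tac x) simp_all

lemma gen_c_eq:
  "gen_c l = seq_cons (l 0) (if even (l 0) then gen_a (seq_tl l) else gen_d (seq_tl l))"
  by (rule ext, case_tac x) simp_all

lemma gen_d_eq:
  "gen_d l = (if even (l 0) then l else seq_cons (l 0) (gen_b (seq_tl l)))"
  by (rule ext, case_tac x) (simp_all add: seq_tl_def)

definition group_H :: "((nat \<Rightarrow> int) \<Rightarrow> (nat \<Rightarrow> int)) monoid"
  where "group_H = subgroup_generated (BijGroup UNIV) {gen_a, gen_b, gen_c, gen_d}"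

fun inv_b inv_c inv_d :: "(nat \<Rightarrow> int) \<Rightarrow> nat \<Rightarrow> int"
  where
    "inv_b l 0 = l 0"
  | "inv_b l (Suc n) =
      (if even (l 0) then seq_cons (seq_tl l 0 - 1) (seq_tl (seq_tl l)) n else inv_c (seq_tl l) n)"
  | "inv_c l 0 = l 0"
  | "inv_c l (Suc n) =
      (if even (l 0) then seq_cons (seq_tl l 0 - 1) (seq_tl (seq_tl l)) n else inv_d (seq_tl l) n)"
  | "inv_d l 0 = l 0"
  | "inv_d l (Suc n) = (if even (l 0) then seq_tl l n else inv_b (seq_tl l) n)"

lemma inv_b_eq:
  "inv_b l = seq_cons (l 0) (if even (l 0) then seq_cons (seq_tl l 0 - 1) (seq_tl (seq_tl l))
     else inv_c (seq_tl l))"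
  by (rule ext, case_tac x) simp_all

lemma inv_c_eq:
  "inv_c l = seq_cons (l 0) (if even (l 0) then seq_cons (seq_tl l 0 - 1) (seq_tl (seq_tl l))
     else inv_d (seq_tl l))"
  by (rule ext, case_tac x) simp_all

lemma inv_d_eq:
  "inv_d l = seq_cons (l 0) (if even (l 0) then seq_tl l else inv_b (seq_tl l))"
  by (rule ext, case_tac x) simp_all

lemma gen_inv:
  "gen_b (inv_b l) n = l n" "gen_c (inv_c l) n = l n" "gen_d (inv_d l) n = l n"
proof (induction n arbitrary: l)
  case 0
  { case 1 show ?case by (simp add: inv_b_eq) next
    case 2 show ?case by (simp add: inv_c_eq) next
    case 3 show ?case by (simp add: inv_d_eq) }
next
  case (Suc n)
  { case 1 show ?case using Suc
      by (simp add: inv_b_eq gen_a_def seq_cons_tl) (simp add: seq_tl_def) next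
    case 2 show ?case using Suc
      by (simp add: inv_c_eq gen_a_def seq_cons_tl) (simp add: seq_tl_def) next
    case 3 show ?case using Suc
      by (simp add: inv_d_eq) (simp add: seq_tl_def) }
qed

lemma inv_gen:
  "inv_b (gen_b l) n = l n" "inv_c (gen_c l) n = l n" "inv_d (gen_d l) n = l n"
proof (induction n arbitrary: l)
  case 0
  { case 1 show ?case by simp next
    case 2 show ?case by simp next
    case 3 show ?case by simp }
next
  case (Suc n)
  { case 1 show ?case using Suc
      by (simp add: gen_b_eq gen_a_def seq_cons_tl) (simp add: seq_tl_def) next
    case 2 show ?case using Suc
      by (simp add: gen_c_eq gen_a_def seq_cons_tl) (simp add: seq_tl_def) next
    case 3 show ?case using Suc
      by (simp add: gen_d_eq) (simp add: seq_tl_def) }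
qed

lemma bij_gen: "bij gen_a" "bij gen_b" "bij gen_c" "bij gen_d"
proof -
  show "bij gen_a"
    by (rule o_bij[where g = "\<lambda>l. seq_cons (l 0 - 1) (seq_tl l)"])
      (auto simp: fun_eq_iff gen_a_def seq_cons_tl)
  show "bij gen_b" "bij gen_c" "bij gen_d"
    by (rule o_bij[where g = inv_b] o_bij[where g = inv_c] o_bij[where g = inv_d];
        simp add: fun_eq_iff gen_inv inv_gen)+
qed

lemma gens_in_Bij: "{gen_a, gen_b, gen_c, gen_d} \<subseteq> carrier (BijGroup UNIV)"
  using bij_gen by (simp add: BijGroup_def Bij_def)

lemma carrier_group_H: "carrier group_H = generate (BijGroup UNIV) {gen_a, gen_b, gen_c, gen_d}"
  unfolding group_H_def carrier_subgroup_generated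
  using gens_in_Bij by (simp add: Int_absorb1)

section \<open>Orientation preserving diffeomorphisms of the unit interval\<close>

text \<open>Derivatives are taken within the interval, hence one-sided at the endpoints.\<close>

definition deriv01 :: "(real \<Rightarrow> real) \<Rightarrow> real \<Rightarrow> real"
  where "deriv01 f x = vector_derivative f (at x within {0..1})"

definition C1_on01 :: "(real \<Rightarrow> real) \<Rightarrow> bool"
  where "C1_on01 f \<longleftrightarrow>
    (\<forall>x\<in>{0..1}. f differentiable (at x within {0..1})) \<and> continuous_on {0..1} (deriv01 f)"

definition Diff1_set :: "(real \<Rightarrow> real) set"
  where "Diff1_set = {f \<in> Bij {0..1}.
    C1_on01 f \<and> C1_on01 (inv_into {0..1} f) \<and> strict_mono_on {0..1} f}"

definition Diff1 :: "(real \<Rightarrow> real) monoid"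
  where "Diff1 = BijGroup {0..1} \<lparr>carrier := Diff1_set\<rparr>"

definition C1_topology :: "(real \<Rightarrow> real) topology"
  where "C1_topology = topology (\<lambda>U. U \<subseteq> Diff1_set \<and>
    (\<forall>f\<in>U. \<exists>\<epsilon>>0. \<forall>g\<in>Diff1_set.
      (\<forall>x\<in>{0..1}. \<bar>g x - f x\<bar> < \<epsilon> \<and> \<bar>deriv01 g x - deriv01 f x\<bar> < \<epsilon>) \<longrightarrow> g \<in> U))"

lemma openin_C1_topology:
  "openin C1_topology U \<longleftrightarrow> U \<subseteq> Diff1_set \<and>
    (\<forall>f\<in>U. \<exists>\<epsilon>>0. \<forall>g\<in>Diff1_set.
      (\<forall>x\<in>{0..1}. \<bar>g x - f x\<bar> < \<epsilon> \<and> \<bar>deriv01 g x - deriv01 f x\<bar> < \<epsilon>) \<longrightarrow> g \<in> U)"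
proof -
  define near where "near e f g \<longleftrightarrow>
    (\<forall>x\<in>{0..1}. \<bar>g x - f x\<bar> < e \<and> \<bar>deriv01 g x - deriv01 f x\<bar> < e)" for e f g
  have mono: "near e f g" if "near d f g" "d \<le> e" for d e f g
    using that unfolding near_def by force
  have "istopology (\<lambda>U. U \<subseteq> Diff1_set \<and> (\<forall>f\<in>U. \<exists>e>0. \<forall>g\<in>Diff1_set. near e f g \<longrightarrow> g \<in> U))"
    unfolding istopology_def
  proof (intro conjI allI impI ballI)
    fix S T f
    assume S: "S \<subseteq> Diff1_set \<and> (\<forall>f\<in>S. \<exists>e>0. \<forall>g\<in>Diff1_set. near e f g \<longrightarrow> g \<in> S)"
      and T: "T \<subseteq> Diff1_set \<and> (\<forall>f\<in>T. \<exists>e>0. \<forall>g\<in>Diff1_set. near e f g \<longrightarrow> g \<in> T)"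
    then show "S \<inter> T \<subseteq> Diff1_set" by blast
    assume f: "f \<in> S \<inter> T"
    obtain d e where d: "d > 0" "\<forall>g\<in>Diff1_set. near d f g \<longrightarrow> g \<in> S"
      and e: "e > 0" "\<forall>g\<in>Diff1_set. near e f g \<longrightarrow> g \<in> T"
      using S T f by blast
    show "\<exists>e>0. \<forall>g\<in>Diff1_set. near e f g \<longrightarrow> g \<in> S \<inter> T"
    proof (intro exI[of _ "min d e"] conjI ballI impI)
      show "0 < min d e" using d e by simp
      fix g assume g: "g \<in> Diff1_set" "near (min d e) f g"
      show "g \<in> S \<inter> T"
        using d(2) e(2) g mono[OF g(2) min.cobounded1] mono[OF g(2) min.cobounded2] by blast
    qed
  next
    fix \<U> f
    assume U: "\<forall>S\<in>\<U>. S \<subseteq> Diff1_set \<and> (\<forall>f\<in>S. \<exists>e>0. \<forall>g\<in>Diff1_set. near e f g \<longrightarrow> g \<in> S)"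
    then show "\<Union>\<U> \<subseteq> Diff1_set" by blast
    assume "f \<in> \<Union>\<U>"
    then obtain S where S: "S \<in> \<U>" "f \<in> S" by blast
    then obtain e where "e > 0" "\<forall>g\<in>Diff1_set. near e f g \<longrightarrow> g \<in> S" using U by blast
    then show "\<exists>e>0. \<forall>g\<in>Diff1_set. near e f g \<longrightarrow> g \<in> \<Union>\<U>" using S by blast
  qed
  from topology_inverse'[OF this] show ?thesis
    unfolding C1_topology_def near_def by simp
qed

lemma topspace_C1_topology: "topspace C1_topology = Diff1_set"
proof
  show "topspace C1_topology \<subseteq> Diff1_set"
    by (auto simp: topspace_def openin_C1_topology)
  have "openin C1_topology Diff1_set"
    unfolding openin_C1_topology by (auto intro: exI[of _ "1::real"])
  then show "Diff1_set \<subseteq> topspace C1_topology" by (rule openin_subset)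
qed

lemma C1_on01_iff:
  "C1_on01 f \<longleftrightarrow> (\<exists>D. (\<forall>x\<in>{0..1}. (f has_real_derivative D x) (at x within {0..1})) \<and>
    continuous_on {0..1} D)"
proof
  assume "C1_on01 f"
  then show "\<exists>D. (\<forall>x\<in>{0..1}. (f has_real_derivative D x) (at x within {0..1})) \<and>
      continuous_on {0..1} D"
    unfolding C1_on01_def deriv01_def
    by (intro exI[of _ "deriv01 f"])
      (auto simp: vector_derivative_works has_real_derivative_iff_has_vector_derivative
        deriv01_def[abs_def])
next
  assume "\<exists>D. (\<forall>x\<in>{0..1}. (f has_real_derivative D x) (at x within {0..1})) \<and>
      continuous_on {0..1} D"
  then obtain D where D: "\<And>x. x \<in> {0..1} \<Longrightarrow> (f has_real_derivative D x) (at x within {0..1})"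
    "continuous_on {0..1} D" by blast
  have eq: "deriv01 f x = D x" if "x \<in> {0..1}" for x
    unfolding deriv01_def using D(1)[OF that] that
    by (intro vector_derivative_within_closed_interval)
      (auto simp: has_real_derivative_iff_has_vector_derivative)
  have "continuous_on {0..1} (deriv01 f)"
    using D(2) eq by (metis (no_types, lifting) continuous_on_cong)
  moreover have "f differentiable (at x within {0..1})" if "x \<in> {0..1}" for x
    using D(1)[OF that] by (metis differentiableI_vector has_real_derivative_iff_has_vector_derivative)
  ultimately show "C1_on01 f"
    unfolding C1_on01_def by blast
qed

lemma C1_on01_cong:
  assumes "\<And>x. x \<in> {0..1} \<Longrightarrow> f x = g x"
  shows "C1_on01 f \<longleftrightarrow> C1_on01 g"
proof -
  have "(f has_real_derivative D) (at x within {0..1}) \<longleftrightarrow>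
      (g has_real_derivative D) (at x within {0..1})" if "x \<in> {0..1}" for x D
    using that assms by (intro has_field_derivative_cong_eventually)
      (auto simp: eventually_at_filter)
  then show ?thesis unfolding C1_on01_iff by meson
qed

lemma C1_on01_compose:
  assumes f: "C1_on01 f" and g: "C1_on01 g" and im: "f ` {0..1} \<subseteq> {0..1}"
  shows "C1_on01 (\<lambda>x. g (f x))"
proof -
  obtain D E where D: "\<And>x. x \<in> {0..1} \<Longrightarrow> (f has_real_derivative D x) (at x within {0..1})"
      "continuous_on {0..1} D"
    and E: "\<And>x. x \<in> {0..1} \<Longrightarrow> (g has_real_derivative E x) (at x within {0..1})"
      "continuous_on {0..1} E"
    using f g unfolding C1_on01_iff by blast
  have "continuous_on {0..1} f"
    using D(1) by (rule DERIV_continuous_on)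
  then have "continuous_on {0..1} (\<lambda>x. E (f x) * D x)"
    using D(2) im by (intro continuous_intros continuous_on_compose2[OF E(2)]) auto
  moreover have "((\<lambda>x. g (f x)) has_real_derivative E (f x) * D x) (at x within {0..1})"
    if "x \<in> {0..1}" for x
  proof -
    have "f x \<in> {0..1}" using im that by blast
    then show ?thesis
      using DERIV_image_chain[OF DERIV_subset[OF E(1) im] D(1)[OF that]] by (simp add: o_def)
  qed
  ultimately show ?thesis
    unfolding C1_on01_iff by (intro exI[of _ "\<lambda>x. E (f x) * D x"] conjI ballI)
qed

lemma subgroup_Diff1: "subgroup Diff1_set (BijGroup {0..1})"
proof (rule group.subgroupI[OF group_BijGroup])
  show "Diff1_set \<subseteq> carrier (BijGroup {0..1})"
    by (auto simp: Diff1_set_def BijGroup_def)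
  let ?i = "\<lambda>x\<in>{0..1::real}. x"
  have id: "C1_on01 (\<lambda>x. x)"
    unfolding C1_on01_iff by (intro exI[of _ "\<lambda>_. 1"]) auto
  have "inv_into {0..1} ?i x = x" if "x \<in> {0..1}" for x
    using that Bij_imp_funcset[OF id_Bij] by (intro inv_into_f_eq) (auto simp: inj_on_def)
  then have "C1_on01 (inv_into {0..1} ?i)" "C1_on01 ?i"
    using id C1_on01_cong[of "inv_into {0..1} ?i" "\<lambda>x. x"] C1_on01_cong[of ?i "\<lambda>x. x"] by auto
  then have "?i \<in> Diff1_set"
    by (auto simp: Diff1_set_def id_Bij strict_mono_on_def)
  then show "Diff1_set \<noteq> {}" by blast
next
  fix f assume f: "f \<in> Diff1_set"
  then have B: "f \<in> Bij {0..1}" by (simp add: Diff1_set_def)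
  then have bij: "bij_betw f {0..1} {0..1}" by (simp add: Bij_def)
  let ?g = "restrict (inv_into {0..1} f) {0..1}"
  have gB: "?g \<in> Bij {0..1}" by (rule restrict_inv_into_Bij[OF B])
  then have gbij: "bij_betw ?g {0..1} {0..1}" by (simp add: Bij_def)
  have inv: "inv\<^bsub>BijGroup {0..1}\<^esub> f = ?g" by (rule inv_BijGroup[OF B])
  have fin: "f x \<in> {0..1}" if "x \<in> {0..1}" for x
    using bij that by (rule bij_betwE[rule_format])
  have "inv_into {0..1} ?g x = f x" if x: "x \<in> {0..1}" for x
    using gbij x fin[OF x] bij
    by (intro inv_into_f_eq) (auto simp: bij_betw_def)
  then have "C1_on01 (inv_into {0..1} ?g)"
    using f C1_on01_cong[of "inv_into {0..1} ?g" f] by (simp add: Diff1_set_def)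
  moreover have "C1_on01 ?g"
    using f C1_on01_cong[of ?g "inv_into {0..1} f"] by (simp add: Diff1_set_def)
  moreover have "strict_mono_on {0..1} ?g"
  proof (rule strict_mono_onI)
    fix r s :: real assume rs: "r \<in> {0..1}" "s \<in> {0..1}" "r < s"
    have mono: "strict_mono_on {0..1} f" using f by (simp add: Diff1_set_def)
    have "?g r \<in> {0..1}" "?g s \<in> {0..1}" using gbij rs by (auto dest: bij_betwE)
    moreover have "f (?g r) = r" "f (?g s) = s"
      using rs bij by (auto simp: bij_betw_inv_into_right)
    ultimately show "?g r < ?g s"
      using mono rs(3) by (metis linorder_less_linear order_less_asym strict_mono_onD)
  qed
  ultimately show "inv\<^bsub>BijGroup {0..1}\<^esub> f \<in> Diff1_set"
    using gB by (simp add: Diff1_set_def inv)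
next
  fix f g assume fg: "f \<in> Diff1_set" "g \<in> Diff1_set"
  then have B: "f \<in> Bij {0..1}" "g \<in> Bij {0..1}" by (simp_all add: Diff1_set_def)
  then have bij: "bij_betw f {0..1} {0..1}" "bij_betw g {0..1} {0..1}" by (simp_all add: Bij_def)
  let ?h = "compose {0..1} f g"
  have hB: "?h \<in> Bij {0..1}" using B by (rule compose_Bij)
  have C: "C1_on01 f" "C1_on01 g" "C1_on01 (inv_into {0..1} f)" "C1_on01 (inv_into {0..1} g)"
    using fg by (simp_all add: Diff1_set_def)
  have img: "g ` {0..1} \<subseteq> {0..1}" "inv_into {0..1} f ` {0..1} \<subseteq> {0..1}"
    using bij bij_betw_inv_into[OF bij(1)] by (auto simp: bij_betw_def)
  have "C1_on01 ?h"
    using C1_on01_compose[OF C(2,1) img(1)] C1_on01_cong[of ?h "\<lambda>x. f (g x)"]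
    by (simp add: compose_def)
  moreover have "inv_into {0..1} ?h x = inv_into {0..1} g (inv_into {0..1} f x)"
    if x: "x \<in> {0..1}" for x
  proof (rule inv_into_f_eq)
    show "inj_on ?h {0..1}" using hB by (simp add: Bij_def bij_betw_def)
    have y: "inv_into {0..1} f x \<in> {0..1}" using img(2) x by blast
    then show z: "inv_into {0..1} g (inv_into {0..1} f x) \<in> {0..1}"
      using bij_betw_inv_into[OF bij(2)] bij_betwE by blast
    show "?h (inv_into {0..1} g (inv_into {0..1} f x)) = x"
      using x y z bij by (simp only: compose_eq bij_betw_inv_into_right)
  qed
  then have "C1_on01 (inv_into {0..1} ?h)"
    using C1_on01_compose[OF C(3,4) img(2)]
      C1_on01_cong[of "inv_into {0..1} ?h" "\<lambda>x. inv_into {0..1} g (inv_into {0..1} f x)"] by blast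
  moreover have "strict_mono_on {0..1} ?h"
  proof (rule strict_mono_onI)
    fix r s :: real assume rs: "r \<in> {0..1}" "s \<in> {0..1}" "r < s"
    have mono: "strict_mono_on {0..1} f" "strict_mono_on {0..1} g"
      using fg by (simp_all add: Diff1_set_def)
    have "g r \<in> {0..1}" "g s \<in> {0..1}" using img(1) rs by blast+
    then show "?h r < ?h s"
      using strict_mono_onD[OF mono(1)] strict_mono_onD[OF mono(2) rs] rs
      by (simp add: compose_eq)
  qed
  ultimately show "f \<otimes>\<^bsub>BijGroup {0..1}\<^esub> g \<in> Diff1_set"
    using hB B by (simp add: Diff1_set_def BijGroup_def)
qed

lemma group_Diff1: "group Diff1"
  unfolding Diff1_def by (rule subgroup.subgroup_is_group[OF subgroup_Diff1 group_BijGroup])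

end

theory Submission
  imports Defs "HOL-Library.List_Lexorder"
begin

text \<open>The group \<open>H\<close> preserves the lexicographic order of the tree of finite integer sequences, on which it
acts by truncation. Choose positive lengths of total sum \<open>1\<close> for the nodes \<open>s\<close> of this tree, and lay
out pairwise disjoint intervals \<open>I s\<close> of these lengths in \<open>[0,1]\<close> in lexicographic order. An
order automorphism \<open>\<sigma>\<close> of the nodes is realized by a homeomorphism of \<open>[0,1]\<close> that maps
\<open>I s\<close> onto \<open>I (\<sigma> s)\<close> by a member of Yoccoz' family \<open>yoccoz u v : [0,u] \<rightarrow> [0,v]\<close>. This family
is equivariant, \<open>yoccoz v w \<circ> yoccoz u v = yoccoz u w\<close>, so the realization is multiplicative
(\<open>realize_comp\<close>); its members have derivative \<open>1\<close> at both end points and a derivative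
between \<open>1\<close> and \<open>(v/u)\<^sup>2\<close> elsewhere. Hence, if the ratios \<open>len (\<sigma> s) / len s\<close> tend to
\<open>1\<close> as \<open>s\<close> leaves finite sets, the pieces fit together to a \<open>C\<^sup>1\<close> map with derivative
\<open>1\<close> off the intervals (\<open>realize_has_derivative\<close>), and if all ratios are uniformly close to \<open>1\<close>
then this map is \<open>C\<^sup>1\<close>-close to the identity (\<open>diffeo_near_id\<close>).

It remains to choose the lengths. A generator of \<open>H\<close> changes at most one coordinate of a sequence,
and that one by \<open>1\<close> (\<open>gens_displacement\<close>). For a node \<open>s = (s\<^sub>1, \<dots>, s\<^sub>n)\<close> put,
for a constant \<open>K \<ge> 5\<close>, \<open>f = K (n + 1)\<^sup>2 + \<bar>s\<^sub>1\<bar> + \<dots> + \<bar>s\<^sub>n\<bar>\<close> and let the length be proportional to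
\<open>f powr (- 2 n)\<close>. These numbers are summable because \<open>f \<ge> 5 + \<bar>s\<^sub>i\<bar>\<close>, so that the sum is dominated by
\<open>\<Sum>\<^sub>n (\<Sum>\<^sub>k (5 + \<bar>k\<bar>) powr (- 2)) ^ n\<close>, a geometric series of ratio at most \<open>1/2\<close>
(\<open>weight_summable\<close>). A generator changes \<open>f\<close> by at most \<open>1\<close>, hence the logarithm of the length by at
most \<open>4 n / f\<close> (\<open>ln_weight_ratio\<close>), which tends to \<open>0\<close> at infinity and is at most \<open>4 / K\<close>
everywhere. Taking \<open>K\<close> large brings the generators into any given neighbourhood of the identity.
The representation is faithful since an element of \<open>H\<close> is determined by its action on the nodes.

Using nodes of all depths, instead of nested intervals indexed by initial segments of one
infinite sequence, means that every depth has its own intervals and no compatibility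
between depths is needed.\<close>

section \<open>Yoccoz diffeomorphisms between intervals\<close>

text \<open>A lift to the real line of the projective map \<open>tan \<theta> \<mapsto> r * tan \<theta>\<close>, written
relative to the identity so that one formula is valid for all angles, including the poles of
the tangent.\<close>

definition stretch :: "real \<Rightarrow> real \<Rightarrow> real" where
  "stretch r \<theta> = \<theta> + arctan ((r - 1) * sin \<theta> * cos \<theta> / ((cos \<theta>)\<^sup>2 + r * (sin \<theta>)\<^sup>2))"

lemma cos_sin_combination_pos:
  fixes c :: real
  assumes "c > 0"
  shows "(cos \<theta>)\<^sup>2 + c * (sin \<theta>)\<^sup>2 > 0"
proof (cases "sin \<theta> = 0")
  case True
  then show ?thesis using sin_cos_squared_add[of \<theta>] by simp
next
  case False
  then show ?thesis using assms by (simp add: add_nonneg_pos)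
qed

lemma stretch_norm_identity:
  fixes r :: real
  shows "((cos \<theta>)\<^sup>2 + r * (sin \<theta>)\<^sup>2)\<^sup>2 + ((r - 1) * sin \<theta> * cos \<theta>)\<^sup>2 = (cos \<theta>)\<^sup>2 + r\<^sup>2 * (sin \<theta>)\<^sup>2"
proof -
  have "((cos \<theta>)\<^sup>2 + r * (sin \<theta>)\<^sup>2)\<^sup>2 + ((r - 1) * sin \<theta> * cos \<theta>)\<^sup>2
      = ((cos \<theta>)\<^sup>2 + r\<^sup>2 * (sin \<theta>)\<^sup>2) * ((sin \<theta>)\<^sup>2 + (cos \<theta>)\<^sup>2)"
    by algebra
  then show ?thesis by simp
qed

text \<open>The direction of \<open>stretch r \<theta>\<close> is that of the vector \<open>(cos \<theta>, r sin \<theta>)\<close>.\<close>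

lemma stretch_cos_sin:
  fixes r \<theta> :: real
  assumes r: "r > 0"
  defines "\<rho> \<equiv> sqrt ((cos \<theta>)\<^sup>2 + r\<^sup>2 * (sin \<theta>)\<^sup>2)"
  shows "cos (stretch r \<theta>) = cos \<theta> / \<rho>" "sin (stretch r \<theta>) = r * sin \<theta> / \<rho>"
proof -
  define M where "M = (cos \<theta>)\<^sup>2 + r * (sin \<theta>)\<^sup>2"
  define N where "N = (r - 1) * sin \<theta> * cos \<theta>"
  have M: "M > 0" using cos_sin_combination_pos[OF r] by (simp add: M_def)
  have \<rho>: "\<rho> > 0" using cos_sin_combination_pos[of "r\<^sup>2" \<theta>] r by (simp add: \<rho>_def)
  have "\<rho> = sqrt (M\<^sup>2 + N\<^sup>2)"
    using stretch_norm_identity[of \<theta> r] by (simp add: \<rho>_def M_def N_def)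
  moreover have "1 + (N / M)\<^sup>2 = (M\<^sup>2 + N\<^sup>2) / M\<^sup>2"
    using M by (simp add: field_simps)
  ultimately have s: "sqrt (1 + (N / M)\<^sup>2) = \<rho> / M"
    using M by (simp add: real_sqrt_divide)
  have c: "cos (arctan (N / M)) = M / \<rho>"
    by (simp add: cos_arctan s)
  have d: "sin (arctan (N / M)) = N / \<rho>"
    using M by (simp add: sin_arctan s)
  have eq: "stretch r \<theta> = \<theta> + arctan (N / M)"
    by (simp add: stretch_def M_def N_def)
  have "cos (stretch r \<theta>) = (cos \<theta> * M - sin \<theta> * N) / \<rho>"
    by (simp add: eq cos_add c d diff_divide_distrib)
  also have "cos \<theta> * M - sin \<theta> * N = cos \<theta> * ((sin \<theta>)\<^sup>2 + (cos \<theta>)\<^sup>2)"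
    unfolding M_def N_def by algebra
  finally show "cos (stretch r \<theta>) = cos \<theta> / \<rho>" by simp
  have "sin (stretch r \<theta>) = (sin \<theta> * M + cos \<theta> * N) / \<rho>"
    by (simp add: eq sin_add c d add_divide_distrib)
  also have "sin \<theta> * M + cos \<theta> * N = r * sin \<theta> * ((sin \<theta>)\<^sup>2 + (cos \<theta>)\<^sup>2)"
    unfolding M_def N_def by algebra
  finally show "sin (stretch r \<theta>) = r * sin \<theta> / \<rho>" by simp
qed

lemma stretch_has_derivative:
  assumes r: "r > 0"
  shows "(stretch r has_real_derivative r / ((cos \<theta>)\<^sup>2 + r\<^sup>2 * (sin \<theta>)\<^sup>2)) (at \<theta>)"
proof -
  define M where "M = (cos \<theta>)\<^sup>2 + r * (sin \<theta>)\<^sup>2"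
  define N where "N = (r - 1) * sin \<theta> * cos \<theta>"
  define R where "R = (cos \<theta>)\<^sup>2 + r\<^sup>2 * (sin \<theta>)\<^sup>2"
  define M' where "M' = 2 * (r - 1) * sin \<theta> * cos \<theta>"
  define N' where "N' = (r - 1) * ((cos \<theta>)\<^sup>2 - (sin \<theta>)\<^sup>2)"
  have M: "M > 0" using cos_sin_combination_pos[OF r] by (simp add: M_def)
  have R: "R > 0" using cos_sin_combination_pos[of "r\<^sup>2" \<theta>] r by (simp add: R_def)
  have MN: "M\<^sup>2 + N\<^sup>2 = R"
    using stretch_norm_identity[of \<theta> r] by (simp add: M_def N_def R_def)
  have dM: "((\<lambda>\<theta>. (cos \<theta>)\<^sup>2 + r * (sin \<theta>)\<^sup>2) has_real_derivative M') (at \<theta>)"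
    unfolding M'_def by (auto intro!: derivative_eq_intros simp: algebra_simps)
  have dN: "((\<lambda>\<theta>. (r - 1) * sin \<theta> * cos \<theta>) has_real_derivative N') (at \<theta>)"
    unfolding N'_def by (auto intro!: derivative_eq_intros simp: algebra_simps power2_eq_square)
  have dq: "((\<lambda>\<theta>. (r - 1) * sin \<theta> * cos \<theta> / ((cos \<theta>)\<^sup>2 + r * (sin \<theta>)\<^sup>2)) has_real_derivative
      (N' * M - N * M') / (M * M)) (at \<theta>)"
    using DERIV_divide[OF dN dM] M by (simp add: M_def N_def)
  have e: "1 + inverse (1 + (N / M)\<^sup>2) * ((N' * M - N * M') / (M * M)) = r / R"
  proof -
    have 1: "inverse (1 + (N / M)\<^sup>2) * ((N' * M - N * M') / (M * M)) = (N' * M - N * M') / R"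
    proof -
      have "1 + (N / M)\<^sup>2 = R / (M * M)"
        using M by (simp add: MN[symmetric] field_simps power2_eq_square)
      then show ?thesis using M by simp
    qed
    have 2: "R + (N' * M - N * M') = r"
    proof -
      have "R + (N' * M - N * M') = r * ((sin \<theta>)\<^sup>2 + (cos \<theta>)\<^sup>2)^2
          + R * (1 - ((sin \<theta>)\<^sup>2 + (cos \<theta>)\<^sup>2))"
        unfolding R_def M_def N_def M'_def N'_def by algebra
      then show ?thesis by simp
    qed
    have "1 + (N' * M - N * M') / R = (R + (N' * M - N * M')) / R"
      using R by (simp only: add_divide_distrib) simp
    then show ?thesis unfolding 1 2 .
  qed
  have "((\<lambda>\<theta>. \<theta> + arctan ((r - 1) * sin \<theta> * cos \<theta> / ((cos \<theta>)\<^sup>2 + r * (sin \<theta>)\<^sup>2)))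
     has_real_derivative 1 + inverse (1 + (N / M)\<^sup>2) * ((N' * M - N * M') / (M * M))) (at \<theta>)"
    using DERIV_add[OF DERIV_ident DERIV_chain2[OF DERIV_arctan dq]] by (simp add: M_def N_def)
  then show ?thesis
    unfolding e unfolding R_def stretch_def[abs_def] .
qed

text \<open>Both sides agree at \<open>0\<close> and have the same derivative.\<close>

lemma stretch_stretch:
  assumes r: "r > 0" and s: "s > 0"
  shows "stretch r (stretch s \<theta>) = stretch (r * s) \<theta>"
proof -
  let ?h = "\<lambda>\<theta>. stretch r (stretch s \<theta>) - stretch (r * s) \<theta>"
  have "(?h has_real_derivative 0) (at \<theta>)" for \<theta>
  proof -
    let ?R = "(cos \<theta>)\<^sup>2 + s\<^sup>2 * (sin \<theta>)\<^sup>2"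
    have R: "?R > 0" using cos_sin_combination_pos[of "s\<^sup>2" \<theta>] s by simp
    have T: "(cos \<theta>)\<^sup>2 + (r * s)\<^sup>2 * (sin \<theta>)\<^sup>2 > 0"
      using cos_sin_combination_pos[of "(r * s)\<^sup>2" \<theta>] r s by simp
    have "(cos (stretch s \<theta>))\<^sup>2 + r\<^sup>2 * (sin (stretch s \<theta>))\<^sup>2
        = ((cos \<theta>)\<^sup>2 + (r * s)\<^sup>2 * (sin \<theta>)\<^sup>2) / ?R"
      using R by (simp add: stretch_cos_sin[OF s] power_divide power_mult_distrib add_divide_distrib)
    then have "r / ((cos (stretch s \<theta>))\<^sup>2 + r\<^sup>2 * (sin (stretch s \<theta>))\<^sup>2) * (s / ?R)
        = r * s / ((cos \<theta>)\<^sup>2 + (r * s)\<^sup>2 * (sin \<theta>)\<^sup>2)"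
      using R T by (simp add: field_simps)
    then show ?thesis
      using DERIV_diff[OF DERIV_chain2[OF stretch_has_derivative[OF r] stretch_has_derivative[OF s, of \<theta>]]
        stretch_has_derivative[of "r * s" \<theta>]] r s by simp
  qed
  then have "?h \<theta> = ?h 0" using DERIV_isconst_all[of ?h \<theta> 0] by blast
  then show ?thesis by (simp add: stretch_def)
qed

text \<open>The Yoccoz diffeomorphism from \<open>[0,u]\<close> onto \<open>[0,v]\<close>: it is \<open>x \<mapsto> y\<close> with
\<open>cot (\<pi> y / v) / v = cot (\<pi> x / u) / u\<close>. The formula makes sense on the whole real line, which
avoids one-sided derivatives at the end points.\<close>

definition yoccoz :: "real \<Rightarrow> real \<Rightarrow> real \<Rightarrow> real" where
  "yoccoz u v x = v / pi * stretch (u / v) (pi * x / u)"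

text \<open>The derivative of \<open>yoccoz u v\<close>.\<close>

definition yoccoz_deriv :: "real \<Rightarrow> real \<Rightarrow> real \<Rightarrow> real" where
  "yoccoz_deriv u v x = 1 / ((cos (pi * x / u))\<^sup>2 + (u / v)\<^sup>2 * (sin (pi * x / u))\<^sup>2)"

lemma yoccoz_0 [simp]: "yoccoz u v 0 = 0"
  by (simp add: yoccoz_def stretch_def)

lemma yoccoz_end: "u > 0 \<Longrightarrow> yoccoz u v u = v"
  by (simp add: yoccoz_def stretch_def)

lemma yoccoz_refl: "u > 0 \<Longrightarrow> yoccoz u u x = x"
  by (simp add: yoccoz_def stretch_def)

lemma yoccoz_yoccoz:
  assumes "u > 0" "v > 0" "w > 0"
  shows "yoccoz v w (yoccoz u v x) = yoccoz u w x"
proof -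
  have "v / w * (u / v) = u / w" using assms by simp
  then show ?thesis using assms stretch_stretch[of "v / w" "u / v"] by (simp add: yoccoz_def)
qed

lemma yoccoz_has_derivative:
  assumes "u > 0" "v > 0"
  shows "(yoccoz u v has_real_derivative yoccoz_deriv u v x) (at x)"
proof -
  define R where "R = (cos (pi * x / u))\<^sup>2 + (u / v)\<^sup>2 * (sin (pi * x / u))\<^sup>2"
  have "((\<lambda>x. pi * x / u) has_real_derivative pi / u) (at x)"
    using assms by (auto intro!: derivative_eq_intros)
  from DERIV_cmult[OF DERIV_chain2[OF stretch_has_derivative this], of "u / v" "v / pi"]
  have "(yoccoz u v has_real_derivative v / pi * (u / v / R * (pi / u))) (at x)"
    using assms by (simp add: yoccoz_def[abs_def] R_def)
  moreover have "v / pi * (u / v / R * (pi / u)) = 1 / R"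
    using assms by (simp add: field_simps)
  ultimately show ?thesis by (simp add: yoccoz_deriv_def R_def)
qed

lemma yoccoz_deriv_pos:
  assumes "u > 0" "v > 0"
  shows "yoccoz_deriv u v x > 0"
  unfolding yoccoz_deriv_def using assms by (simp add: cos_sin_combination_pos)

lemma yoccoz_mono:
  assumes "u > 0" "v > 0" "x \<le> y"
  shows "yoccoz u v x \<le> yoccoz u v y"
  using yoccoz_has_derivative[OF assms(1,2)] yoccoz_deriv_pos[OF assms(1,2)]
  by (intro DERIV_nonneg_imp_nondecreasing[OF assms(3)]) (meson less_imp_le)

lemma yoccoz_deriv_ends: "yoccoz_deriv u v 0 = 1" "u > 0 \<Longrightarrow> yoccoz_deriv u v u = 1"
  by (simp_all add: yoccoz_deriv_def)

lemma continuous_yoccoz_deriv: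
  assumes "u > 0" "v > 0"
  shows "continuous_on A (yoccoz_deriv u v)"
proof -
  have "(cos (pi * x / u))\<^sup>2 + (u / v)\<^sup>2 * (sin (pi * x / u))\<^sup>2 \<noteq> 0" for x
    using cos_sin_combination_pos[of "(u / v)\<^sup>2" "pi * x / u"] assms by simp
  then show ?thesis
    unfolding yoccoz_deriv_def[abs_def] by (intro continuous_intros) (use assms in auto)
qed

lemma yoccoz_deriv_bound:
  assumes "u > 0" "v > 0"
  shows "\<bar>yoccoz_deriv u v x - 1\<bar> \<le> \<bar>(v / u)\<^sup>2 - 1\<bar>"
proof -
  define c where "c = (v / u)\<^sup>2"
  define t where "t = (sin (pi * x / u))\<^sup>2"
  have c: "c > 0" using assms by (simp add: c_def)
  have t: "0 \<le> t" "t \<le> 1" by (auto simp: t_def abs_square_le_1)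
  have ct: "c * (1 - t) + t > 0"
    using c t by (cases "t = 1") (auto intro: add_pos_nonneg)
  have "yoccoz_deriv u v x = 1 / ((1 - t) + 1 / c * t)"
    by (simp add: yoccoz_deriv_def t_def c_def cos_squared_eq power_divide)
  also have "\<dots> = c / (c * (1 - t) + t)"
    using c by (simp add: field_simps)
  finally have "yoccoz_deriv u v x - 1 = (c - 1) * (t / (c * (1 - t) + t))"
    using ct by (simp add: field_simps)
  moreover have "\<bar>t / (c * (1 - t) + t)\<bar> \<le> 1"
    using c t ct by simp
  ultimately show ?thesis
    unfolding c_def[symmetric] by (simp only: abs_mult mult_left_le abs_ge_zero)
qed

text \<open>The retraction of the real line onto \<open>[0,u]\<close>.\<close>

definition trim :: "real \<Rightarrow> real \<Rightarrow> real" where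
  "trim u x = max 0 (min u x)"

lemma trim_bounds: "u \<ge> 0 \<Longrightarrow> 0 \<le> trim u x" "u \<ge> 0 \<Longrightarrow> trim u x \<le> u"
  and trim_below: "x \<le> 0 \<Longrightarrow> trim u x = 0"
  and trim_above: "u \<ge> 0 \<Longrightarrow> u \<le> x \<Longrightarrow> trim u x = u"
  and trim_inside: "0 \<le> x \<Longrightarrow> x \<le> u \<Longrightarrow> trim u x = x"
  and trim_mono: "x \<le> y \<Longrightarrow> trim u x \<le> trim u y"
  and trim_lipschitz: "\<bar>trim u y - trim u x\<bar> \<le> \<bar>y - x\<bar>"
  by (auto simp: trim_def)

lemma continuous_trim: "continuous_on A (trim u)"
  unfolding trim_def[abs_def] by (intro continuous_intros)

text \<open>The function \<open>c\<close> need not be differentiable; this is applied to the retraction \<open>trim u\<close> at its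
two corners.\<close>

lemma DERIV_zero_compose_contraction:
  fixes c k :: "real \<Rightarrow> real"
  assumes k: "(k has_real_derivative 0) (at (c x))"
    and c: "\<And>y. \<bar>c y - c x\<bar> \<le> \<bar>y - x\<bar>"
  shows "((\<lambda>y. k (c y)) has_real_derivative 0) (at x)"
  unfolding has_field_derivative_def has_derivative_at_alt
proof (intro conjI allI impI)
  show "bounded_linear ((*) (0::real))" by (rule bounded_linear_mult_right)
  fix e :: real assume e: "e > 0"
  obtain d where d: "d > 0" "\<And>z. norm (z - c x) < d \<Longrightarrow> norm (k z - k (c x)) \<le> e * norm (z - c x)"
    using k e unfolding has_field_derivative_def has_derivative_at_alt by auto
  show "\<exists>d>0. \<forall>y. norm (y - x) < d \<longrightarrow> norm (k (c y) - k (c x) - 0 * (y - x)) \<le> e * norm (y - x)"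
  proof (intro exI[of _ d] conjI allI impI d(1))
    fix y assume y: "norm (y - x) < d"
    have "norm (c y - c x) < d" using c[of y] y by simp
    then have "norm (k (c y) - k (c x)) \<le> e * norm (c y - c x)" by (rule d(2))
    also have "\<dots> \<le> e * norm (y - x)" using c[of y] e by (simp add: mult_left_mono)
    finally show "norm (k (c y) - k (c x) - 0 * (y - x)) \<le> e * norm (y - x)" by simp
  qed
qed

text \<open>The displacement of \<open>yoccoz u v\<close>, continued by constants outside \<open>[0,u]\<close>. As
\<open>yoccoz u v\<close> has derivative \<open>1\<close> at the end points, this is a \<open>C\<^sup>1\<close> function on the real line,
whereas the continuation of \<open>yoccoz u v\<close> itself is not.\<close>

definition bump :: "real \<Rightarrow> real \<Rightarrow> real \<Rightarrow> real" where
  "bump u v x = yoccoz u v (trim u x) - trim u x"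

text \<open>The derivative of \<open>bump u v\<close>.\<close>

definition bump_deriv :: "real \<Rightarrow> real \<Rightarrow> real \<Rightarrow> real" where
  "bump_deriv u v x = yoccoz_deriv u v (trim u x) - 1"

lemma bump_has_derivative:
  assumes uv: "u > 0" "v > 0"
  shows "(bump u v has_real_derivative bump_deriv u v x) (at x)"
proof -
  have k: "((\<lambda>x. yoccoz u v x - x) has_real_derivative yoccoz_deriv u v x - 1) (at x)" for x
    by (intro derivative_intros yoccoz_has_derivative uv)
  show ?thesis
  proof (cases "0 < x \<and> x < u")
    case True
    then have "((\<lambda>x. yoccoz u v x - x) has_real_derivative bump_deriv u v x) (at x)"
      using k[of x] by (simp add: bump_deriv_def trim_inside)
    then show ?thesis
      by (rule has_field_derivative_transform_within_open[of _ _ _ "{0<..<u}"])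
        (use True in \<open>auto simp: bump_def trim_inside\<close>)
  next
    case False
    then have "trim u x = 0 \<or> trim u x = u"
      using uv by (auto simp: trim_below trim_above)
    then have 0: "yoccoz_deriv u v (trim u x) - 1 = 0"
      using uv by (auto simp: yoccoz_deriv_ends)
    have "((\<lambda>y. yoccoz u v (trim u y) - trim u y) has_real_derivative 0) (at x)"
      by (rule DERIV_zero_compose_contraction) (use k[of "trim u x"] 0 trim_lipschitz in auto)
    then show ?thesis using 0 by (simp add: bump_def[abs_def] bump_deriv_def)
  qed
qed

lemma bump_deriv_outside:
  assumes "u > 0" "bump_deriv u v x \<noteq> 0"
  shows "0 < x" "x < u"
proof -
  have "trim u x \<noteq> 0 \<and> trim u x \<noteq> u"
    using assms by (auto simp: bump_deriv_def yoccoz_deriv_ends)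
  then show "0 < x" "x < u"
    using assms(1) by (auto simp: trim_def)
qed

lemma bump_deriv_bound:
  assumes "u > 0" "v > 0"
  shows "\<bar>bump_deriv u v x\<bar> \<le> \<bar>(v / u)\<^sup>2 - 1\<bar>"
  using yoccoz_deriv_bound[OF assms] by (simp add: bump_deriv_def)

lemma continuous_bump_deriv:
  assumes "u > 0" "v > 0"
  shows "continuous_on A (bump_deriv u v)"
  unfolding bump_deriv_def[abs_def]
  by (intro continuous_intros continuous_on_compose2[OF continuous_yoccoz_deriv[OF assms, of UNIV]]
      continuous_trim) auto

section \<open>Realizing order automorphisms on the interval\<close>

lemma has_sum_diff_real:
  fixes f g :: "'a \<Rightarrow> real"
  assumes "(f has_sum a) A" "(g has_sum b) A"
  shows "((\<lambda>x. f x - g x) has_sum a - b) A"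
  using has_sum_add[OF assms(1) has_sum_uminusI[OF assms(2)]] by simp

text \<open>An infinite countable linear order whose elements carry positive lengths of total sum \<open>1\<close>.\<close>

locale weighted_order =
  fixes len :: "'a::{linorder,countable} \<Rightarrow> real"
  assumes len_pos: "len s > 0"
    and len_has_sum: "(len has_sum 1) UNIV"
    and infinite_index: "infinite (UNIV :: 'a set)"
begin

text \<open>The total length of a set of elements.\<close>

definition mass :: "'a set \<Rightarrow> real" where
  "mass A = infsum len A"

text \<open>The interval of \<open>s\<close> is \<open>[start s, start s + len s]\<close>.\<close>

definition start :: "'a \<Rightarrow> real" where
  "start s = mass {..<s}"

lemma len_nonneg: "len s \<ge> 0"
  using len_pos[of s] by simp

lemma has_sum_mass: "(len has_sum mass A) A"
  unfolding mass_def
  by (intro has_sum_infsum summable_on_subset_banach[OF has_sum_imp_summable[OF len_has_sum]]) simp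

lemma mass_mono: "A \<subseteq> B \<Longrightarrow> mass A \<le> mass B"
  using has_sum_mono2[OF has_sum_mass has_sum_mass] len_nonneg by blast

lemma mass_UNIV: "mass UNIV = 1"
  using len_has_sum by (simp add: mass_def infsumI)

lemma mass_empty: "mass {} = 0"
  by (simp add: mass_def)

lemma mass_Un: "A \<inter> B = {} \<Longrightarrow> mass (A \<union> B) = mass A + mass B"
  using has_sum_Un_disjoint[OF has_sum_mass has_sum_mass] has_sum_mass by (metis has_sum_unique)

lemma mass_finite: "finite A \<Longrightarrow> mass A = sum len A"
  by (simp add: mass_def)

lemma mass_nonneg: "0 \<le> mass A"
  using mass_mono[of "{}" A] by (simp add: mass_empty)

lemma mass_le_1: "mass A \<le> 1"
  using mass_mono[of A UNIV] by (simp add: mass_UNIV)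

lemma mass_atMost: "mass {..s} = start s + len s"
proof -
  have "{..s} = {..<s} \<union> {s}" by auto
  then show ?thesis using mass_Un[of "{..<s}" "{s}"] by (simp add: start_def mass_finite)
qed

lemma start_nonneg: "0 \<le> start s"
  by (simp add: start_def mass_nonneg)

lemma end_le_1: "start s + len s \<le> 1"
  using mass_le_1[of "{..s}"] by (simp add: mass_atMost)

lemma end_le_start: "s < t \<Longrightarrow> start s + len s \<le> start t"
  unfolding mass_atMost[symmetric] start_def[of t] by (rule mass_mono) auto

lemma inj_start: "inj start"
proof (rule injI)
  fix s t assume "start s = start t"
  then show "s = t"
    using end_le_start[of s t] end_le_start[of t s] len_pos[of s] len_pos[of t]
    by (cases s t rule: linorder_cases) auto
qed

text \<open>Up to the point \<open>x\<close>, finitely many of the intervals cover a length of at most \<open>x\<close>; the next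
lemma is the same for the part to the right of \<open>x\<close>. Since the total length is \<open>1\<close>, the two bounds
force equality in the limit (\<open>trim_has_sum\<close>), which says that the complement of the
intervals has measure zero.\<close>

lemma sum_trim_le:
  assumes "finite F" "0 \<le> x"
  shows "(\<Sum>s\<in>F. trim (len s) (x - start s)) \<le> x"
  using assms(1)
proof (induction rule: finite_linorder_max_induct)
  case empty
  then show ?case using assms by simp
next
  case (insert b A)
  have b: "b \<notin> A" using insert by blast
  show ?case
  proof (cases "start b \<le> x")
    case True
    have "(\<Sum>s\<in>A. trim (len s) (x - start s)) \<le> sum len A"
      by (intro sum_mono trim_bounds len_nonneg)
    also have "\<dots> \<le> start b"
      unfolding mass_finite[OF insert(1), symmetric] start_def using insert by (intro mass_mono) auto
    finally show ?thesis using b insert(1) True by (simp add: trim_def)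
  next
    case False
    then show ?thesis using b insert by (simp add: trim_below)
  qed
qed

lemma sum_len_minus_trim_le:
  assumes "finite F" "x \<le> 1"
  shows "(\<Sum>s\<in>F. len s - trim (len s) (x - start s)) \<le> 1 - x"
  using assms(1)
proof (induction rule: finite_linorder_min_induct)
  case empty
  then show ?case using assms by simp
next
  case (insert b A)
  have b: "b \<notin> A" using insert by blast
  show ?case
  proof (cases "x \<le> start b + len b")
    case True
    have "(\<Sum>s\<in>A. len s - trim (len s) (x - start s)) \<le> sum len A"
      by (intro sum_mono) (simp add: trim_bounds len_nonneg)
    moreover have "sum len A + (start b + len b) \<le> 1"
      unfolding mass_finite[OF insert(1), symmetric] mass_atMost[symmetric]
      using insert by (subst mass_Un[symmetric]) (auto simp: mass_le_1)
    moreover have "len b - trim (len b) (x - start b) \<le> start b + len b - x"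
      using True by (auto simp: trim_def)
    ultimately show ?thesis using b insert(1) by simp
  next
    case False
    then show ?thesis using b insert len_nonneg by (simp add: trim_above)
  qed
qed

lemma trim_has_sum:
  assumes x: "x \<in> {0..1}"
  shows "((\<lambda>s. trim (len s) (x - start s)) has_sum x) UNIV"
proof -
  let ?c = "\<lambda>s. trim (len s) (x - start s)"
  have sm: "?c summable_on UNIV"
    by (rule summable_on_comparison_test[OF has_sum_imp_summable[OF len_has_sum]])
      (auto simp: trim_bounds len_nonneg)
  then have s: "(?c has_sum infsum ?c UNIV) UNIV" by (rule has_sum_infsum)
  have "infsum ?c UNIV \<le> x"
    by (rule infsum_le_finite_sums[OF sm]) (use x sum_trim_le in auto)
  moreover have "1 - infsum ?c UNIV \<le> 1 - x"
    by (rule has_sum_le_finite_sums[OF has_sum_diff_real[OF len_has_sum s]])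
      (use x sum_len_minus_trim_le in auto)
  ultimately show ?thesis using s by (simp add: antisym)
qed

text \<open>Every point is in one of the intervals or is the total length of an initial
segment \<open>L\<close>.\<close>

lemma cover:
  assumes x: "x \<in> {0..1}"
  obtains (interval) s t where "0 \<le> t" "t \<le> len s" "x = start s + t"
  | (gap) L where "\<And>s t. s \<in> L \<Longrightarrow> t < s \<Longrightarrow> t \<in> L" "x = mass L"
proof (cases "\<exists>s. start s \<le> x \<and> x \<le> start s + len s")
  case True
  then obtain s where "start s \<le> x" "x \<le> start s + len s" by blast
  then show ?thesis using interval[of "x - start s" s] by simp
next
  case False
  define L where "L = {s. start s + len s \<le> x}"
  have "trim (len s) (x - start s) = (if s \<in> L then len s else 0)" for s
  proof (cases "x \<le> start s")
    case True
    then show ?thesis using False len_pos[of s] by (auto simp: L_def trim_below)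
  next
    case less: False
    then have "start s + len s \<le> x" using False by (meson linorder_le_cases)
    then show ?thesis using len_nonneg[of s] by (simp add: L_def trim_above)
  qed
  then have "((\<lambda>s. if s \<in> L then len s else 0) has_sum x) UNIV"
    using trim_has_sum[OF x] by simp
  also have "?this \<longleftrightarrow> (len has_sum x) L"
    by (rule has_sum_cong_neutral) auto
  finally have "x = mass L" using has_sum_mass has_sum_unique by blast
  moreover have "t \<in> L" if "s \<in> L" "t < s" for s t
    using that end_le_start[of t s] len_nonneg[of s] by (simp add: L_def)
  ultimately show ?thesis using gap by blast
qed

text \<open>Automorphisms of the linear order.\<close>

definition order_auto :: "('a \<Rightarrow> 'a) \<Rightarrow> bool" where
  "order_auto \<sigma> \<longleftrightarrow> bij \<sigma> \<and> strict_mono \<sigma>"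

text \<open>The length of the part of the image interval of \<open>s\<close> that lies to the left of the image of \<open>x\<close>.\<close>

definition piece :: "('a \<Rightarrow> 'a) \<Rightarrow> 'a \<Rightarrow> real \<Rightarrow> real" where
  "piece \<sigma> s x = yoccoz (len s) (len (\<sigma> s)) (trim (len s) (x - start s))"

text \<open>The map of \<open>[0,1]\<close> that takes the interval of \<open>s\<close> to that of \<open>\<sigma> s\<close> by a Yoccoz diffeomorphism.
Writing it as a sum of monotone functions defines it on the remaining points as well.\<close>

definition realize :: "('a \<Rightarrow> 'a) \<Rightarrow> real \<Rightarrow> real" where
  "realize \<sigma> x = (\<Sum>\<^sub>\<infinity>s. piece \<sigma> s x)"

lemma piece_below: "x \<le> start s \<Longrightarrow> piece \<sigma> s x = 0"
  by (simp add: piece_def trim_below)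

lemma piece_above: "start s + len s \<le> x \<Longrightarrow> piece \<sigma> s x = len (\<sigma> s)"
  by (simp add: piece_def trim_above len_nonneg len_pos yoccoz_end)

lemma piece_bounds: "0 \<le> piece \<sigma> s x" "piece \<sigma> s x \<le> len (\<sigma> s)"
  using yoccoz_mono[OF len_pos len_pos, of 0 "trim (len s) (x - start s)" s "\<sigma> s"]
    yoccoz_mono[OF len_pos len_pos, of "trim (len s) (x - start s)" "len s" s "\<sigma> s"]
  by (simp_all add: piece_def trim_bounds len_nonneg yoccoz_end len_pos)

lemma piece_mono: "x \<le> y \<Longrightarrow> piece \<sigma> s x \<le> piece \<sigma> s y"
  unfolding piece_def by (intro yoccoz_mono len_pos trim_mono) simp

lemma order_auto_less_iff: "order_auto \<sigma> \<Longrightarrow> \<sigma> s < \<sigma> t \<longleftrightarrow> s < t"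
  by (simp add: order_auto_def strict_mono_less)

lemma order_auto_image_lessThan:
  assumes "order_auto \<sigma>"
  shows "\<sigma> ` {..<s} = {..<\<sigma> s}"
proof
  show "\<sigma> ` {..<s} \<subseteq> {..<\<sigma> s}" using order_auto_less_iff[OF assms] by auto
  show "{..<\<sigma> s} \<subseteq> \<sigma> ` {..<s}"
  proof
    fix t assume "t \<in> {..<\<sigma> s}"
    moreover obtain r where "t = \<sigma> r"
      using assms unfolding order_auto_def by (meson bij_pointE)
    ultimately show "t \<in> \<sigma> ` {..<s}" using order_auto_less_iff[OF assms] by auto
  qed
qed

lemma order_auto_inv:
  assumes "order_auto \<sigma>"
  shows "order_auto (inv_into UNIV \<sigma>)"
proof -
  have b: "bij \<sigma>" using assms by (simp add: order_auto_def)
  have "strict_mono (inv_into UNIV \<sigma>)"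
  proof (rule strict_monoI)
    fix s t :: 'a assume "s < t"
    then show "inv_into UNIV \<sigma> s < inv_into UNIV \<sigma> t"
      using order_auto_less_iff[OF assms, of "inv_into UNIV \<sigma> s" "inv_into UNIV \<sigma> t"] b
      by (simp add: bij_is_surj surj_f_inv_f)
  qed
  then show ?thesis using b by (simp add: order_auto_def bij_imp_bij_inv)
qed

lemma order_auto_comp: "order_auto \<sigma> \<Longrightarrow> order_auto \<tau> \<Longrightarrow> order_auto (\<sigma> \<circ> \<tau>)"
  unfolding order_auto_def by (auto simp: strict_mono_def intro: bij_comp)

lemma has_sum_len_image:
  assumes "order_auto \<sigma>"
  shows "((\<lambda>s. len (\<sigma> s)) has_sum mass (\<sigma> ` L)) L"
proof -
  have "inj_on \<sigma> L" using assms by (auto simp: order_auto_def bij_def intro: inj_on_subset)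
  then show ?thesis using has_sum_mass[of "\<sigma> ` L"] by (simp add: has_sum_reindex o_def)
qed

lemma piece_has_sum:
  assumes "order_auto \<sigma>"
  shows "((\<lambda>s. piece \<sigma> s x) has_sum realize \<sigma> x) UNIV"
  unfolding realize_def
  by (intro has_sum_infsum
      summable_on_comparison_test[OF has_sum_imp_summable[OF has_sum_len_image[OF assms]]] piece_bounds)

lemma realize_mono:
  assumes "order_auto \<sigma>" "x \<le> y"
  shows "realize \<sigma> x \<le> realize \<sigma> y"
  by (rule has_sum_mono[OF piece_has_sum[OF assms(1)] piece_has_sum[OF assms(1)]])
    (rule piece_mono[OF assms(2)])

lemma realize_gap:
  assumes \<sigma>: "order_auto \<sigma>" and L: "\<And>s t. s \<in> L \<Longrightarrow> t < s \<Longrightarrow> t \<in> L"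
  shows "realize \<sigma> (mass L) = mass (\<sigma> ` L)"
proof -
  have in_L: "piece \<sigma> s (mass L) = len (\<sigma> s)" if "s \<in> L" for s
  proof -
    have "{..s} \<subseteq> L" using L that by (auto simp: order_le_less)
    then show ?thesis by (intro piece_above) (metis mass_mono mass_atMost)
  qed
  have not_L: "piece \<sigma> s (mass L) = 0" if "s \<notin> L" for s
  proof -
    have "L \<subseteq> {..<s}" using L that by (metis lessThan_iff linorder_less_linear subsetI)
    then show ?thesis unfolding start_def by (intro piece_below) (auto simp: start_def mass_mono)
  qed
  have "((\<lambda>s. piece \<sigma> s (mass L)) has_sum mass (\<sigma> ` L)) UNIV
      \<longleftrightarrow> ((\<lambda>s. len (\<sigma> s)) has_sum mass (\<sigma> ` L)) L"
    by (rule has_sum_cong_neutral) (auto simp: in_L not_L)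
  then show ?thesis
    using has_sum_len_image[OF \<sigma>] piece_has_sum[OF \<sigma>] has_sum_unique by blast
qed

lemma realize_interval:
  assumes \<sigma>: "order_auto \<sigma>" and t: "0 \<le> t" "t \<le> len s"
  shows "realize \<sigma> (start s + t) = start (\<sigma> s) + yoccoz (len s) (len (\<sigma> s)) t"
proof -
  let ?p = "\<lambda>r. piece \<sigma> r (start s + t)"
  have 1: "?p s = yoccoz (len s) (len (\<sigma> s)) t"
    using t by (simp add: piece_def trim_inside)
  have 2: "?p r = len (\<sigma> r)" if "r < s" for r
    using end_le_start[OF that] t by (intro piece_above) auto
  have 3: "?p r = 0" if "s < r" for r
    using end_le_start[OF that] t by (intro piece_below) auto
  have "((\<lambda>r. len (\<sigma> r)) has_sum start (\<sigma> s)) {..<s}"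
    using has_sum_len_image[OF \<sigma>, of "{..<s}"] by (simp add: order_auto_image_lessThan[OF \<sigma>] start_def)
  then have "(?p has_sum start (\<sigma> s)) {..<s}"
    using has_sum_cong[of "{..<s}" ?p "\<lambda>r. len (\<sigma> r)"] 2 by simp
  moreover have "(?p has_sum yoccoz (len s) (len (\<sigma> s)) t) {s}"
    by (rule has_sum_finiteI) (simp_all add: 1)
  ultimately have "(?p has_sum start (\<sigma> s) + yoccoz (len s) (len (\<sigma> s)) t) ({..<s} \<union> {s})"
    by (rule has_sum_Un_disjoint) simp
  also have "?this \<longleftrightarrow> (?p has_sum start (\<sigma> s) + yoccoz (len s) (len (\<sigma> s)) t) UNIV"
    by (rule has_sum_cong_neutral) (auto intro!: 3 simp: not_less)
  finally show ?thesis using piece_has_sum[OF \<sigma>] has_sum_unique by blast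
qed

lemma realize_start: "order_auto \<sigma> \<Longrightarrow> realize \<sigma> (start s) = start (\<sigma> s)"
  using realize_interval[of \<sigma> 0 s] by (simp add: len_nonneg)

lemma realize_comp:
  assumes \<sigma>: "order_auto \<sigma>" and \<tau>: "order_auto \<tau>" and x: "x \<in> {0..1}"
  shows "realize (\<sigma> \<circ> \<tau>) x = realize \<sigma> (realize \<tau> x)"
  using x
proof (cases rule: cover)
  case (interval s t)
  let ?y = "yoccoz (len s) (len (\<tau> s)) t"
  have "?y \<le> len (\<tau> s)" "0 \<le> ?y"
    using yoccoz_mono[OF len_pos len_pos, of t "len s" s "\<tau> s"]
      yoccoz_mono[OF len_pos len_pos, of 0 t s "\<tau> s"] interval by (simp_all add: len_pos yoccoz_end)
  then show ?thesis
    using interval by (simp add: realize_interval \<sigma> \<tau> order_auto_comp yoccoz_yoccoz len_pos)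
next
  case (gap L)
  have "t \<in> \<tau> ` L" if "s \<in> \<tau> ` L" "t < s" for s t
  proof -
    obtain r where "r \<in> L" "s = \<tau> r" using \<open>s \<in> \<tau> ` L\<close> by blast
    then show ?thesis
      using gap(1)[of r] \<open>t < s\<close> order_auto_image_lessThan[OF \<tau>, of r] by blast
  qed
  then show ?thesis
    using gap by (simp add: realize_gap \<sigma> \<tau> order_auto_comp image_comp)
qed

lemma realize_id:
  assumes "x \<in> {0..1}"
  shows "realize id x = x"
proof -
  have "piece id s x = trim (len s) (x - start s)" for s
    by (simp add: piece_def yoccoz_refl len_pos)
  then show ?thesis using trim_has_sum[OF assms] by (simp add: realize_def infsumI)
qed

lemma realize_in_interval:
  assumes "order_auto \<sigma>"
  shows "realize \<sigma> x \<in> {0..1}"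
proof -
  have "0 \<le> realize \<sigma> x"
    unfolding realize_def by (intro infsum_nonneg piece_bounds)
  moreover have "realize \<sigma> x \<le> mass (\<sigma> ` UNIV)"
    by (rule has_sum_mono[OF piece_has_sum[OF assms] has_sum_len_image[OF assms]]) (rule piece_bounds)
  ultimately show ?thesis using mass_le_1[of "\<sigma> ` UNIV"] by simp
qed

text \<open>The derivative of \<open>realize \<sigma>\<close> minus \<open>1\<close>. At each point at most one summand is nonzero
(\<open>bump_deriv_disjoint\<close>).\<close>

definition slope :: "('a \<Rightarrow> 'a) \<Rightarrow> real \<Rightarrow> real" where
  "slope \<sigma> x = (\<Sum>\<^sub>\<infinity>s. bump_deriv (len s) (len (\<sigma> s)) (x - start s))"

lemma bump_deriv_disjoint:
  assumes "bump_deriv (len s) v (x - start s) \<noteq> 0" "bump_deriv (len t) w (x - start t) \<noteq> 0"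
  shows "s = t"
proof (cases s t rule: linorder_cases)
  case less
  then show ?thesis
    using end_le_start[of s t] bump_deriv_outside[OF len_pos assms(1)] bump_deriv_outside[OF len_pos assms(2)]
    by linarith
next
  case greater
  then show ?thesis
    using end_le_start[of t s] bump_deriv_outside[OF len_pos assms(1)] bump_deriv_outside[OF len_pos assms(2)]
    by linarith
qed

lemma slope_eq:
  assumes "bump_deriv (len s) (len (\<sigma> s)) (x - start s) \<noteq> 0"
  shows "slope \<sigma> x = bump_deriv (len s) (len (\<sigma> s)) (x - start s)"
  unfolding slope_def
  by (intro infsumI has_sum_finite_neutralI[of "{s}"]) (use bump_deriv_disjoint[OF assms] in auto)

lemma slope_eq_0:
  assumes "\<And>s. bump_deriv (len s) (len (\<sigma> s)) (x - start s) = 0"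
  shows "slope \<sigma> x = 0"
  unfolding slope_def using assms by simp

lemma slope_bound:
  assumes "\<And>s. \<bar>(len (\<sigma> s) / len s)\<^sup>2 - 1\<bar> \<le> C"
  shows "\<bar>slope \<sigma> x\<bar> \<le> C"
proof (cases "\<exists>s. bump_deriv (len s) (len (\<sigma> s)) (x - start s) \<noteq> 0")
  case True
  then obtain s where "bump_deriv (len s) (len (\<sigma> s)) (x - start s) \<noteq> 0" by blast
  then show ?thesis
    using slope_eq[of s \<sigma> x] bump_deriv_bound[OF len_pos len_pos, of s "\<sigma> s" "x - start s"] assms[of s]
    by simp
next
  case False
  then show ?thesis using slope_eq_0[of \<sigma> x] assms[of undefined] by simp
qed

text \<open>The condition under which the realization of \<open>\<sigma>\<close> is \<open>C\<^sup>1\<close>: for every \<open>e > 0\<close>, all but finitely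
many length ratios are within \<open>e\<close> of \<open>1\<close>.\<close>

definition tame :: "('a \<Rightarrow> 'a) \<Rightarrow> bool" where
  "tame \<sigma> \<longleftrightarrow> ((\<lambda>s. len (\<sigma> s) / len s) \<longlongrightarrow> 1) cofinite"

text \<open>An enumeration of the index set, which turns the unordered sums into series.\<close>

abbreviation enum :: "nat \<Rightarrow> 'a" where
  "enum \<equiv> from_nat_into UNIV"

lemma bij_enum: "bij enum"
  using bij_betw_from_nat_into[OF _ infinite_index] by (simp add: countable_def ex_inj)

text \<open>The summands have disjoint supports and suprema that tend to \<open>0\<close>, hence the series converges
uniformly.\<close>

lemma slope_uniform_limit:
  assumes "tame \<sigma>"
  shows "uniform_limit S (\<lambda>n x. \<Sum>i<n. bump_deriv (len (enum i)) (len (\<sigma> (enum i))) (x - start (enum i)))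
    (slope \<sigma>) sequentially"
  unfolding uniform_limit_iff
proof (intro allI impI)
  fix \<delta> :: real assume \<delta>: "\<delta> > 0"
  let ?b = "\<lambda>s x. bump_deriv (len s) (len (\<sigma> s)) (x - start s)"
  have "((\<lambda>s. \<bar>(len (\<sigma> s) / len s)\<^sup>2 - 1\<bar>) \<longlongrightarrow> \<bar>1\<^sup>2 - 1\<bar>) cofinite"
    using assms unfolding tame_def by (intro tendsto_intros)
  then have "eventually (\<lambda>s. \<bar>(len (\<sigma> s) / len s)\<^sup>2 - 1\<bar> < \<delta>) cofinite"
    using \<delta> by (intro order_tendstoD) auto
  then have "finite {s. \<not> \<bar>(len (\<sigma> s) / len s)\<^sup>2 - 1\<bar> < \<delta>}" (is "finite ?F")
    by (simp add: eventually_cofinite)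
  then have "finite (enum -` ?F)"
    using bij_enum by (intro finite_vimageI) (auto simp: bij_def)
  then obtain N where N: "\<forall>i\<in>enum -` ?F. i < N"
    using finite_nat_set_iff_bounded by blast
  have "dist (\<Sum>i<n. ?b (enum i) x) (slope \<sigma> x) < \<delta>" if n: "n \<ge> N" for n x
  proof (cases "\<exists>s. ?b s x \<noteq> 0")
    case False
    then show ?thesis using \<delta> by (simp add: slope_eq_0)
  next
    case True
    then obtain k where k: "?b (enum k) x \<noteq> 0" using bij_enum by (metis bij_pointE)
    have single: "?b (enum i) x = (if i = k then ?b (enum k) x else 0)" for i
      using bump_deriv_disjoint[OF k] bij_enum by (metis bij_def injD)
    have "(\<Sum>i<n. ?b (enum i) x) = (\<Sum>i<n. if i = k then ?b (enum k) x else 0)"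
      by (intro sum.cong refl single)
    also have "\<dots> = (if k < n then ?b (enum k) x else 0)" by simp
    finally have eq: "(\<Sum>i<n. ?b (enum i) x) = (if k < n then ?b (enum k) x else 0)" .
    show ?thesis
    proof (cases "k < n")
      case True
      then show ?thesis unfolding eq slope_eq[of "enum k" \<sigma> x, OF k] using \<delta> by simp
    next
      case False
      then have "enum k \<notin> ?F" using N n by auto
      then have "\<bar>?b (enum k) x\<bar> < \<delta>"
        using bump_deriv_bound[OF len_pos len_pos, of "enum k" "\<sigma> (enum k)" "x - start (enum k)"] by simp
      then show ?thesis unfolding eq slope_eq[of "enum k" \<sigma> x, OF k] using False by (simp add: dist_real_def)
    qed
  qed
  then show "\<forall>\<^sub>F n in sequentially. \<forall>x\<in>S. dist (\<Sum>i<n. ?b (enum i) x) (slope \<sigma> x) < \<delta>"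
    by (auto simp: eventually_sequentially)
qed

lemma continuous_slope:
  assumes "tame \<sigma>"
  shows "continuous_on S (slope \<sigma>)"
proof (rule uniform_limit_theorem[OF _ slope_uniform_limit[OF assms]])
  show "\<forall>\<^sub>F n in sequentially. continuous_on S
      (\<lambda>x. \<Sum>i<n. bump_deriv (len (enum i)) (len (\<sigma> (enum i))) (x - start (enum i)))"
    by (intro always_eventually allI continuous_intros
        continuous_on_compose2[OF continuous_bump_deriv[OF len_pos len_pos, of UNIV]]) auto
qed simp

text \<open>The sum of the displacements can be differentiated term by term because the derivatives converge
uniformly. The pieces themselves would not do, as they have corners.\<close>

lemma realize_has_derivative:
  assumes \<sigma>: "order_auto \<sigma>" "tame \<sigma>" and x: "x \<in> {0..1}"
  shows "(realize \<sigma> has_real_derivative 1 + slope \<sigma> x) (at x within {0..1})"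
proof -
  let ?f = "\<lambda>n x. bump (len (enum n)) (len (\<sigma> (enum n))) (x - start (enum n))"
  have "((\<lambda>x. x - start s) has_real_derivative 1) (at x within {0..1})" for s x
    by (auto intro!: derivative_eq_intros)
  from DERIV_chain2[OF bump_has_derivative[OF len_pos len_pos] this]
  have d: "(?f n has_real_derivative bump_deriv (len (enum n)) (len (\<sigma> (enum n))) (x - start (enum n)))
      (at x within {0..1})" for n x by simp
  have "?f n 0 = 0" for n
    by (simp add: bump_def trim_below start_nonneg)
  then have "summable (\<lambda>n. ?f n 0)" by simp
  then have "\<exists>g. \<forall>x\<in>{0..1}. (\<lambda>n. ?f n x) sums g x \<and>
      (g has_real_derivative slope \<sigma> x) (at x within {0..1})"
    by (intro has_field_derivative_series[OF _ d slope_uniform_limit[OF \<sigma>(2)], where ?x0.0 = 0]) auto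
  then obtain g where g: "\<And>x. x \<in> {0..1} \<Longrightarrow> (\<lambda>n. ?f n x) sums g x"
    "\<And>x. x \<in> {0..1} \<Longrightarrow> (g has_real_derivative slope \<sigma> x) (at x within {0..1})"
    by blast
  have eq: "realize \<sigma> y = y + g y" if y: "y \<in> {0..1}" for y
  proof -
    have "((\<lambda>s. piece \<sigma> s y - trim (len s) (y - start s)) has_sum realize \<sigma> y - y) UNIV"
      by (intro has_sum_diff_real piece_has_sum \<sigma> trim_has_sum y)
    then have "((\<lambda>n. piece \<sigma> (enum n) y - trim (len (enum n)) (y - start (enum n)))
        has_sum realize \<sigma> y - y) UNIV"
      using has_sum_reindex_bij_betw[OF bij_enum,
          of "\<lambda>s. piece \<sigma> s y - trim (len s) (y - start s)"] by simp
    then have "(\<lambda>n. ?f n y) sums (realize \<sigma> y - y)"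
      by (intro has_sum_imp_sums) (simp add: bump_def piece_def)
    then show ?thesis using g(1)[OF y] sums_unique2 by fastforce
  qed
  have "((\<lambda>y. y + g y) has_real_derivative 1 + slope \<sigma> x) (at x within {0..1})"
    by (intro derivative_intros g(2) x)
  then show ?thesis
    by (rule has_field_derivative_transform_within[OF _ zero_less_one x]) (simp add: eq)
qed

lemma realize_near_id:
  assumes \<sigma>: "order_auto \<sigma>" "tame \<sigma>" and C: "\<And>s. \<bar>(len (\<sigma> s) / len s)\<^sup>2 - 1\<bar> \<le> C"
    and x: "x \<in> {0..1}"
  shows "\<bar>realize \<sigma> x - x\<bar> \<le> C"
proof -
  have "norm ((realize \<sigma> x - x) - (realize \<sigma> 0 - 0)) \<le> C * norm (x - 0)"
  proof (rule field_differentiable_bound[of "{0..1}" "\<lambda>x. realize \<sigma> x - x" "slope \<sigma>"])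
    fix z :: real assume "z \<in> {0..1}"
    from DERIV_diff[OF realize_has_derivative[OF \<sigma> this] DERIV_ident]
    show "((\<lambda>x. realize \<sigma> x - x) has_real_derivative slope \<sigma> z) (at z within {0..1})" by simp
    show "norm (slope \<sigma> z) \<le> C" using slope_bound[OF C] by simp
  qed (use x in auto)
  moreover have "realize \<sigma> 0 = 0"
    using realize_gap[OF \<sigma>(1), of "{}"] by (simp add: mass_empty)
  moreover have "C * \<bar>x\<bar> \<le> C"
    using x C[of undefined] by (intro mult_left_le) auto
  ultimately show ?thesis by simp
qed

lemma filterlim_bij_cofinite:
  fixes \<sigma> :: "'a \<Rightarrow> 'a"
  assumes "bij \<sigma>"
  shows "filterlim \<sigma> cofinite cofinite"
  unfolding filterlim_iff eventually_cofinite
proof (intro allI impI)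
  fix P :: "'a \<Rightarrow> bool" assume "finite {s. \<not> P s}"
  then have "finite (\<sigma> -` {s. \<not> P s})"
    using assms by (intro finite_vimageI) (auto simp: bij_def)
  then show "finite {s. \<not> P (\<sigma> s)}" by (simp add: vimage_def)
qed

lemma tame_comp:
  assumes "tame \<sigma>" "tame \<tau>" "bij \<tau>"
  shows "tame (\<sigma> \<circ> \<tau>)"
proof -
  have "((\<lambda>s. len (\<sigma> (\<tau> s)) / len (\<tau> s)) \<longlongrightarrow> 1) cofinite"
    using filterlim_compose[OF assms(1)[unfolded tame_def] filterlim_bij_cofinite[OF assms(3)]] .
  from tendsto_mult[OF this assms(2)[unfolded tame_def]]
  show ?thesis using len_pos by (simp add: tame_def less_imp_neq[symmetric])
qed

lemma tame_inv:
  assumes "tame \<sigma>" "bij \<sigma>"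
  shows "tame (inv_into UNIV \<sigma>)"
proof -
  have "((\<lambda>s. len (\<sigma> (inv_into UNIV \<sigma> s)) / len (inv_into UNIV \<sigma> s)) \<longlongrightarrow> 1) cofinite"
    using filterlim_compose[OF assms(1)[unfolded tame_def]
        filterlim_bij_cofinite[OF bij_imp_bij_inv[OF assms(2)]]] .
  from tendsto_inverse[OF this]
  show ?thesis using assms(2) by (simp add: tame_def bij_is_surj surj_f_inv_f)
qed

text \<open>The realization as an element of \<open>Diff1\<close>, where functions have the value \<open>undefined\<close> outside \<open>[0,1]\<close>.\<close>

definition diffeo :: "('a \<Rightarrow> 'a) \<Rightarrow> real \<Rightarrow> real" where
  "diffeo \<sigma> = (\<lambda>x\<in>{0..1}. realize \<sigma> x)"

lemma realize_inv:
  assumes "order_auto \<sigma>" "x \<in> {0..1}"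
  shows "realize \<sigma> (realize (inv_into UNIV \<sigma>) x) = x" "realize (inv_into UNIV \<sigma>) (realize \<sigma> x) = x"
proof -
  have "\<sigma> \<circ> inv_into UNIV \<sigma> = id" "inv_into UNIV \<sigma> \<circ> \<sigma> = id"
    using assms(1) by (auto simp: order_auto_def bij_def surj_iff)
  then show "realize \<sigma> (realize (inv_into UNIV \<sigma>) x) = x" "realize (inv_into UNIV \<sigma>) (realize \<sigma> x) = x"
    using realize_comp[OF assms(1) order_auto_inv[OF assms(1)] assms(2)]
      realize_comp[OF order_auto_inv[OF assms(1)] assms(1) assms(2)] realize_id[OF assms(2)] by auto
qed

lemma C1_diffeo:
  assumes "order_auto \<sigma>" "tame \<sigma>"
  shows "C1_on01 (diffeo \<sigma>)"
proof -
  have "C1_on01 (realize \<sigma>)"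
    unfolding C1_on01_iff using realize_has_derivative[OF assms] continuous_slope[OF assms(2)]
    by (intro exI[of _ "\<lambda>x. 1 + slope \<sigma> x"]) (auto intro!: continuous_intros)
  then show ?thesis using C1_on01_cong[of "diffeo \<sigma>" "realize \<sigma>"] by (simp add: diffeo_def)
qed

lemma bij_betw_diffeo:
  assumes "order_auto \<sigma>"
  shows "bij_betw (diffeo \<sigma>) {0..1} {0..1}"
  by (rule bij_betw_byWitness[where f' = "realize (inv_into UNIV \<sigma>)"])
    (use realize_in_interval[OF assms] realize_in_interval[OF order_auto_inv[OF assms]]
      realize_inv[OF assms] in \<open>auto simp: diffeo_def\<close>)

lemma diffeo_in_Diff1:
  assumes \<sigma>: "order_auto \<sigma>" "tame \<sigma>"
  shows "diffeo \<sigma> \<in> Diff1_set"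
proof -
  have bij: "bij_betw (diffeo \<sigma>) {0..1} {0..1}" by (rule bij_betw_diffeo[OF \<sigma>(1)])
  have "inv_into {0..1} (diffeo \<sigma>) x = diffeo (inv_into UNIV \<sigma>) x" if "x \<in> {0..1}" for x
    using that bij realize_inv[OF \<sigma>(1) that] realize_in_interval[OF order_auto_inv[OF \<sigma>(1)], of x]
    by (intro inv_into_f_eq) (auto simp: diffeo_def bij_betw_def)
  moreover have "C1_on01 (diffeo (inv_into UNIV \<sigma>))"
    using \<sigma> by (intro C1_diffeo order_auto_inv tame_inv) (auto simp: order_auto_def)
  ultimately have "C1_on01 (inv_into {0..1} (diffeo \<sigma>))"
    using C1_on01_cong by blast
  moreover have "strict_mono_on {0..1} (diffeo \<sigma>)"
  proof (rule strict_mono_onI)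
    fix x y :: real assume xy: "x \<in> {0..1}" "y \<in> {0..1}" "x < y"
    then have "diffeo \<sigma> x \<noteq> diffeo \<sigma> y"
      using bij by (auto simp: bij_betw_def dest: inj_onD)
    moreover have "diffeo \<sigma> x \<le> diffeo \<sigma> y"
      using xy realize_mono[OF \<sigma>(1)] by (simp add: diffeo_def)
    ultimately show "diffeo \<sigma> x < diffeo \<sigma> y" by simp
  qed
  ultimately show ?thesis
    using bij C1_diffeo[OF \<sigma>] by (simp add: Diff1_set_def Bij_def diffeo_def)
qed

lemma diffeo_comp:
  assumes "order_auto \<sigma>" "order_auto \<tau>"
  shows "diffeo (\<sigma> \<circ> \<tau>) = compose {0..1} (diffeo \<sigma>) (diffeo \<tau>)"
  using realize_in_interval[OF assms(2)]
  by (auto simp: fun_eq_iff diffeo_def compose_def realize_comp[OF assms])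

lemma diffeo_inject:
  assumes "order_auto \<sigma>" "order_auto \<tau>" "diffeo \<sigma> = diffeo \<tau>"
  shows "\<sigma> = \<tau>"
proof
  fix s
  have "start s \<in> {0..1}"
    using start_nonneg[of s] end_le_1[of s] len_nonneg[of s] by auto
  then have "realize \<sigma> (start s) = realize \<tau> (start s)"
    using fun_cong[OF assms(3), of "start s"] by (simp add: diffeo_def)
  then show "\<sigma> s = \<tau> s"
    using injD[OF inj_start] by (simp add: realize_start assms)
qed

lemma deriv01_diffeo:
  assumes "order_auto \<sigma>" "tame \<sigma>" "x \<in> {0..1}"
  shows "deriv01 (diffeo \<sigma>) x = 1 + slope \<sigma> x"
proof -
  have "(diffeo \<sigma> has_real_derivative 1 + slope \<sigma> x) (at x within {0..1})"
    by (rule has_field_derivative_transform_within[OF realize_has_derivative[OF assms] zero_less_one assms(3)])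
      (simp add: diffeo_def)
  then show ?thesis
    unfolding deriv01_def using assms(3)
    by (intro vector_derivative_within_closed_interval)
      (auto simp: has_real_derivative_iff_has_vector_derivative)
qed

lemma diffeo_near_id:
  assumes "order_auto \<sigma>" "tame \<sigma>" "\<And>s. \<bar>(len (\<sigma> s) / len s)\<^sup>2 - 1\<bar> \<le> C" "x \<in> {0..1}"
  shows "\<bar>diffeo \<sigma> x - x\<bar> \<le> C" "\<bar>deriv01 (diffeo \<sigma>) x - 1\<bar> \<le> C"
  using realize_near_id[OF assms] slope_bound[OF assms(3)] assms(4)
  by (simp add: diffeo_def, simp add: deriv01_diffeo[OF assms(1,2,4)])

end

section \<open>Tree automorphisms acting on finite sequences\<close>

text \<open>The infinite continuation of a finite sequence by zeros.\<close>

definition pad :: "int list \<Rightarrow> nat \<Rightarrow> int" where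
  "pad s n = (if n < length s then s ! n else 0)"

text \<open>The action on finite sequences: continue, apply \<open>h\<close>, and cut off at the original length. For the
tree automorphisms below, the continuation does not matter.\<close>

definition trunc_act :: "((nat \<Rightarrow> int) \<Rightarrow> nat \<Rightarrow> int) \<Rightarrow> int list \<Rightarrow> int list" where
  "trunc_act h s = map (h (pad s)) [0..<length s]"

text \<open>Bijections of the infinite sequences such that the first \<open>n\<close> entries of the image depend only on
the first \<open>n\<close> entries of the argument, and such that the next entry is increasing in the next entry of
the argument. These are the bijections that come from automorphisms of the tree of finite sequences
respecting the order of the children of each node.\<close>

definition tree_auto :: "((nat \<Rightarrow> int) \<Rightarrow> nat \<Rightarrow> int) \<Rightarrow> bool" where
  "tree_auto h \<longleftrightarrow> bij h \<and> (\<forall>n l m. (\<forall>i<n. l i = m i) \<longrightarrow>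
     (\<forall>i<n. h l i = h m i) \<and> (l n < m n \<longrightarrow> h l n < h m n))"

lemma tree_auto_bij: "tree_auto h \<Longrightarrow> bij h"
  and tree_auto_prefix: "tree_auto h \<Longrightarrow> (\<And>i. i < n \<Longrightarrow> l i = m i) \<Longrightarrow> i < n \<Longrightarrow> h l i = h m i"
  and tree_auto_less: "tree_auto h \<Longrightarrow> (\<And>i. i < n \<Longrightarrow> l i = m i) \<Longrightarrow> l n < m n \<Longrightarrow> h l n < h m n"
  unfolding tree_auto_def by blast+

lemma tree_auto_id: "tree_auto (\<lambda>l. l)"
  by (simp add: tree_auto_def bij_id[unfolded id_def])

lemma tree_auto_comp:
  assumes "tree_auto h" "tree_auto k"
  shows "tree_auto (h \<circ> k)"
  unfolding tree_auto_def
proof (intro conjI allI impI)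
  show "bij (h \<circ> k)" using assms by (simp add: bij_comp tree_auto_bij)
next
  fix n i :: nat and l m :: "nat \<Rightarrow> int"
  assume *: "\<forall>i<n. l i = m i" "i < n"
  show "(h \<circ> k) l i = (h \<circ> k) m i"
    using tree_auto_prefix[OF assms(1), of n "k l" "k m"] tree_auto_prefix[OF assms(2), of n l m] * by simp
next
  fix n :: nat and l m :: "nat \<Rightarrow> int"
  assume *: "\<forall>i<n. l i = m i" "l n < m n"
  show "(h \<circ> k) l n < (h \<circ> k) m n"
    using tree_auto_less[OF assms(1), of n "k l" "k m"] tree_auto_prefix[OF assms(2), of n l m]
      tree_auto_less[OF assms(2), of n l m] * by simp
qed

lemma tree_auto_inv:
  assumes h: "tree_auto h"
  shows "tree_auto (inv_into UNIV h)"
proof -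
  let ?k = "inv_into UNIV h"
  have hk: "h (?k l) = l" for l using tree_auto_bij[OF h] by (simp add: bij_is_surj surj_f_inv_f)
  have pre: "\<forall>i<n. ?k l i = ?k m i" if "\<forall>i<n. l i = m i" for n l m
    using that
  proof (induction n)
    case (Suc n)
    then have IH: "\<And>i. i < n \<Longrightarrow> ?k l i = ?k m i" by simp
    have "\<not> ?k l n < ?k m n" "\<not> ?k m n < ?k l n"
      using tree_auto_less[OF h, of n "?k l" "?k m"] tree_auto_less[OF h, of n "?k m" "?k l"] IH Suc.prems
      by (auto simp: hk)
    then show ?case using IH by (auto simp: less_Suc_eq)
  qed simp
  have less: "?k l n < ?k m n" if "\<forall>i<n. l i = m i" "l n < m n" for n l m
  proof -
    have IH: "\<And>i. i < n \<Longrightarrow> ?k l i = ?k m i" using pre that(1) by blast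
    have "\<not> ?k m n < ?k l n"
      using tree_auto_less[OF h, of n "?k m" "?k l"] IH that(2) by (auto simp: hk)
    moreover have "?k m n \<noteq> ?k l n"
    proof
      assume "?k m n = ?k l n"
      then have "h (?k l) n = h (?k m) n"
        using IH by (intro tree_auto_prefix[OF h, of "Suc n"]) (auto simp: less_Suc_eq)
      then show False using that(2) by (simp add: hk)
    qed
    ultimately show ?thesis by simp
  qed
  show ?thesis
    unfolding tree_auto_def using pre less bij_imp_bij_inv[OF tree_auto_bij[OF h]] by blast
qed

lemma length_trunc_act [simp]: "length (trunc_act h s) = length s"
  by (simp add: trunc_act_def)

lemma nth_trunc_act: "i < length s \<Longrightarrow> trunc_act h s ! i = h (pad s) i"
  by (simp add: trunc_act_def)

lemma trunc_act_comp:
  assumes "tree_auto h"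
  shows "trunc_act (h \<circ> k) s = trunc_act h (trunc_act k s)"
proof (rule nth_equalityI)
  fix i assume "i < length (trunc_act (h \<circ> k) s)"
  then have i: "i < length s" by simp
  have "h (k (pad s)) i = h (pad (trunc_act k s)) i"
    by (rule tree_auto_prefix[OF assms _ i]) (simp add: pad_def nth_trunc_act)
  then show "trunc_act (h \<circ> k) s ! i = trunc_act h (trunc_act k s) ! i"
    using i by (simp add: nth_trunc_act)
qed simp

lemma trunc_act_id: "trunc_act (\<lambda>l. l) s = s"
  by (rule nth_equalityI) (simp_all add: nth_trunc_act, simp add: pad_def)

lemma trunc_act_inverse:
  assumes "tree_auto h"
  shows "trunc_act h (trunc_act (inv_into UNIV h) s) = s" "trunc_act (inv_into UNIV h) (trunc_act h s) = s"
proof -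
  have "h \<circ> inv_into UNIV h = (\<lambda>l. l)" "inv_into UNIV h \<circ> h = (\<lambda>l. l)"
    using tree_auto_bij[OF assms] by (auto simp: fun_eq_iff bij_def surj_f_inv_f)
  then show "trunc_act h (trunc_act (inv_into UNIV h) s) = s" "trunc_act (inv_into UNIV h) (trunc_act h s) = s"
    using trunc_act_comp[OF assms, of "inv_into UNIV h" s] trunc_act_comp[OF tree_auto_inv[OF assms], of h s]
    by (simp_all add: trunc_act_id)
qed

lemma bij_trunc_act: "tree_auto h \<Longrightarrow> bij (trunc_act h)"
  by (rule o_bij[where g = "trunc_act (inv_into UNIV h)"]) (auto simp: fun_eq_iff trunc_act_inverse)

lemma trunc_act_inject:
  assumes "tree_auto h" "tree_auto k" "trunc_act h = trunc_act k"
  shows "h = k"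
proof (intro ext)
  fix l :: "nat \<Rightarrow> int" and n :: nat
  define s where "s = map l [0..<Suc n]"
  have s: "length s = Suc n" "\<And>i. i < Suc n \<Longrightarrow> l i = pad s i"
    by (auto simp: s_def pad_def simp del: upt_Suc)
  have "h l n = h (pad s) n" "k l n = k (pad s) n"
    using tree_auto_prefix[OF assms(1), of "Suc n" l "pad s" n]
      tree_auto_prefix[OF assms(2), of "Suc n" l "pad s" n] s(2) by auto
  moreover have "h (pad s) n = k (pad s) n"
    using nth_trunc_act[of n s h] nth_trunc_act[of n s k] s(1) assms(3) by simp
  ultimately show "h l n = k l n" by simp
qed

text \<open>The order on finite sequences is the lexicographic one, with proper initial segments smaller.\<close>

lemma strict_mono_trunc_act:
  assumes h: "tree_auto h"
  shows "strict_mono (trunc_act h)"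
proof (rule strict_monoI)
  fix s t :: "int list" assume st: "s < t"
  then have "length s < length t \<and> take (length s) t = s \<or>
      (\<exists>i. i < min (length s) (length t) \<and> take i s = take i t \<and> s ! i < t ! i)"
    by (simp add: list_less_def lexord_take_index_conv)
  then have "length s < length t \<and> take (length s) (trunc_act h t) = trunc_act h s \<or>
      (\<exists>i. i < min (length s) (length t) \<and> take i (trunc_act h s) = take i (trunc_act h t) \<and>
        trunc_act h s ! i < trunc_act h t ! i)"
  proof (elim disjE exE conjE)
    assume *: "length s < length t" "take (length s) t = s"
    have "take (length s) (trunc_act h t) = trunc_act h s"
    proof (rule nth_equalityI)
      fix i assume "i < length (take (length s) (trunc_act h t))"
      then have i: "i < length s" by simp
      have "h (pad t) i = h (pad s) i"
        by (rule tree_auto_prefix[OF h _ i]) (use * in \<open>metis nth_take pad_def order_less_trans\<close>)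
      then show "take (length s) (trunc_act h t) ! i = trunc_act h s ! i"
        using i * by (simp add: nth_trunc_act)
    qed (use * in simp)
    then show ?thesis using * by blast
  next
    fix i assume *: "i < min (length s) (length t)" "take i s = take i t" "s ! i < t ! i"
    have pre: "pad s j = pad t j" if "j < i" for j
      using * that by (simp add: pad_def) (metis nth_take)
    have "take i (trunc_act h s) = take i (trunc_act h t)"
    proof (rule nth_equalityI)
      fix j assume "j < length (take i (trunc_act h s))"
      then have j: "j < i" "j < length s" "j < length t" using * by auto
      then show "take i (trunc_act h s) ! j = take i (trunc_act h t) ! j"
        using tree_auto_prefix[OF h, of i "pad s" "pad t" j] pre j by (simp add: nth_trunc_act)
    qed (use * in simp)
    moreover have "trunc_act h s ! i < trunc_act h t ! i"
      using tree_auto_less[OF h, of i "pad s" "pad t"] pre * by (simp add: nth_trunc_act pad_def)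
    ultimately show ?thesis using * by blast
  qed
  then show "trunc_act h s < trunc_act h t"
    by (simp add: list_less_def lexord_take_index_conv)
qed

lemma gen_a_simps: "gen_a l 0 = 1 + l 0" "gen_a l (Suc n) = l (Suc n)"
  by (simp_all add: gen_a_def seq_tl_def)

lemma tree_auto_gens:
  "tree_auto gen_a" "tree_auto gen_b" "tree_auto gen_c" "tree_auto gen_d"
proof -
  define P where "P h n \<longleftrightarrow> (\<forall>l m. (\<forall>i<n. l i = m i) \<longrightarrow>
     (\<forall>i<n. h l i = h m i) \<and> (l n < m n \<longrightarrow> h l n < h m n))"
    for h :: "(nat \<Rightarrow> int) \<Rightarrow> nat \<Rightarrow> int" and n
  have a: "P gen_a n" for n
    unfolding P_def by (cases n) (auto simp: All_less_Suc2 gen_a_simps)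
  have tl: "(\<forall>i<n. h (seq_tl l) i = h (seq_tl m) i) \<and>
      (l (Suc n) < m (Suc n) \<longrightarrow> h (seq_tl l) n < h (seq_tl m) n)"
    if "P h n" "\<forall>i<n. l (Suc i) = m (Suc i)" for h n l m
    using that(1)[unfolded P_def, rule_format, of "seq_tl l" "seq_tl m"] that(2) by (simp add: seq_tl_def)
  have id: "P (\<lambda>l. l) n" for n by (simp add: P_def)
  have bcd: "P gen_b n \<and> P gen_c n \<and> P gen_d n" for n
  proof (induction n)
    case 0
    show ?case by (simp add: P_def)
  next
    case (Suc n)
    show ?case
      unfolding P_def[of _ "Suc n"] All_less_Suc2
      using tl[OF a[of n]] tl[OF id[of n]] tl[of gen_b n] tl[of gen_c n] tl[of gen_d n] Suc by auto
  qed
  have "tree_auto h \<longleftrightarrow> bij h \<and> (\<forall>n. P h n)" for h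
    by (simp add: tree_auto_def P_def)
  then show "tree_auto gen_a" "tree_auto gen_b" "tree_auto gen_c" "tree_auto gen_d"
    using a bcd bij_gen by simp_all
qed

text \<open>Each generator changes at most one coordinate, and that one by \<open>1\<close>. Only this consequence for the
sum of the absolute values is used.\<close>

lemma gens_displacement:
  "\<bar>(\<Sum>i<n. \<bar>gen_a l i\<bar>) - (\<Sum>i<n. \<bar>l i\<bar>)\<bar> \<le> 1"
  "\<bar>(\<Sum>i<n. \<bar>gen_b l i\<bar>) - (\<Sum>i<n. \<bar>l i\<bar>)\<bar> \<le> 1"
  "\<bar>(\<Sum>i<n. \<bar>gen_c l i\<bar>) - (\<Sum>i<n. \<bar>l i\<bar>)\<bar> \<le> 1"
  "\<bar>(\<Sum>i<n. \<bar>gen_d l i\<bar>) - (\<Sum>i<n. \<bar>l i\<bar>)\<bar> \<le> 1"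
proof -
  have a: "\<bar>(\<Sum>i<n. \<bar>gen_a l i\<bar>) - (\<Sum>i<n. \<bar>l i\<bar>)\<bar> \<le> 1" for n l
    by (cases n) (auto simp: sum.lessThan_Suc_shift gen_a_simps simp del: sum.lessThan_Suc)
  have bcd: "\<bar>(\<Sum>i<n. \<bar>gen_b l i\<bar>) - (\<Sum>i<n. \<bar>l i\<bar>)\<bar> \<le> 1 \<and>
    \<bar>(\<Sum>i<n. \<bar>gen_c l i\<bar>) - (\<Sum>i<n. \<bar>l i\<bar>)\<bar> \<le> 1 \<and>
    \<bar>(\<Sum>i<n. \<bar>gen_d l i\<bar>) - (\<Sum>i<n. \<bar>l i\<bar>)\<bar> \<le> 1"
  proof (induction n arbitrary: l)
    case (Suc n)
    have tl: "(\<Sum>i<n. \<bar>l (Suc i)\<bar>) = (\<Sum>i<n. \<bar>seq_tl l i\<bar>)" by (simp add: seq_tl_def)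
    show ?case
      using Suc[of "seq_tl l"] a[where n = n and l = "seq_tl l"]
      by (cases "even (l 0)") (simp_all add: sum.lessThan_Suc_shift tl del: sum.lessThan_Suc)
  qed simp
  show "\<bar>(\<Sum>i<n. \<bar>gen_a l i\<bar>) - (\<Sum>i<n. \<bar>l i\<bar>)\<bar> \<le> 1" by (rule a)
  show "\<bar>(\<Sum>i<n. \<bar>gen_b l i\<bar>) - (\<Sum>i<n. \<bar>l i\<bar>)\<bar> \<le> 1"
    "\<bar>(\<Sum>i<n. \<bar>gen_c l i\<bar>) - (\<Sum>i<n. \<bar>l i\<bar>)\<bar> \<le> 1"
    "\<bar>(\<Sum>i<n. \<bar>gen_d l i\<bar>) - (\<Sum>i<n. \<bar>l i\<bar>)\<bar> \<le> 1"
    using bcd by blast+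
qed

section \<open>Lengths for which the generators are almost isometric\<close>

text \<open>The size of a node of the tree. The quadratic term in the depth keeps \<open>length s / height K s\<close> small
and makes it tend to \<open>0\<close> also along nodes of growing depth.\<close>

definition height :: "real \<Rightarrow> int list \<Rightarrow> real" where
  "height K s = K * (real (length s) + 1)\<^sup>2 + (\<Sum>i<length s. real_of_int \<bar>s ! i\<bar>)"

text \<open>The length, before normalization, of the interval of a node.\<close>

definition weight :: "real \<Rightarrow> int list \<Rightarrow> real" where
  "weight K s = 1 / height K s ^ (2 * length s)"

lemma height_ge_square: "K * (real (length s) + 1)\<^sup>2 \<le> height K s"
  unfolding height_def by (simp add: sum_nonneg)

lemma le_mult_square_length: "K \<ge> 0 \<Longrightarrow> K \<le> K * (real (length s) + 1)\<^sup>2"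
  using mult_left_mono[of 1 "(real (length s) + 1)\<^sup>2" K] by (simp add: one_le_power)

lemma height_ge: "K \<ge> 0 \<Longrightarrow> K \<le> height K s"
  using height_ge_square[of K s] le_mult_square_length[of K s] by simp

lemma height_ge_entry:
  fixes k :: int
  assumes "K \<ge> 0" "k \<in> set s"
  shows "K + real_of_int \<bar>k\<bar> \<le> height K s"
proof -
  obtain i where i: "i < length s" "k = s ! i" using assms(2) by (metis in_set_conv_nth)
  have "real_of_int \<bar>s ! i\<bar> \<le> (\<Sum>i<length s. real_of_int \<bar>s ! i\<bar>)"
    by (rule member_le_sum[of i "{..<length s}" "\<lambda>i. real_of_int \<bar>s ! i\<bar>"]) (use i in auto)
  then show ?thesis using le_mult_square_length[OF assms(1), of s] i by (simp add: height_def)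
qed

text \<open>The constant \<open>5\<close> is chosen such that the sum over all integers is at most \<open>1/2\<close>, which makes the
sum over all finite sequences in the next lemma converge.\<close>

lemma sum_inverse_squares_le:
  assumes "finite (A :: int set)"
  shows "(\<Sum>k\<in>A. 1 / (5 + real_of_int \<bar>k\<bar>)\<^sup>2) \<le> 1 / 2"
proof -
  let ?c = "\<lambda>k. 1 / (5 + real_of_int \<bar>k\<bar>)\<^sup>2"
  have interval: "(\<Sum>k\<in>{-int n..int n}. ?c k) \<le> 1 / 2 - 2 / (5 + real n)" for n
  proof (induction n)
    case (Suc n)
    have "{-int (Suc n)..int (Suc n)} = insert (int (Suc n)) (insert (- int (Suc n)) {-int n..int n})"
      by auto
    then have "(\<Sum>k\<in>{-int (Suc n)..int (Suc n)}. ?c k) = (\<Sum>k\<in>{-int n..int n}. ?c k) + 2 / (6 + real n)\<^sup>2"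
      by (simp add: add.commute)
    \<comment> \<open>telescoping\<close>
    also have "\<dots> \<le> 1 / 2 - 2 / (5 + real n) + 2 / ((5 + real n) * (6 + real n))"
    proof -
      have "2 / (6 + real n)\<^sup>2 \<le> 2 / ((5 + real n) * (6 + real n))"
        by (rule divide_left_mono) (auto simp: power2_eq_square intro!: mult_right_mono)
      then show ?thesis using Suc by linarith
    qed
    also have "2 / ((5 + real n) * (6 + real n)) = 2 / (5 + real n) - 2 / (6 + real n)"
      by (simp add: field_simps)
    also have "1 / 2 - 2 / (5 + real n) + \<dots> = 1 / 2 - 2 / (6 + real n)" by simp
    finally show ?case by (simp add: add.commute)
  qed simp
  obtain n where n: "A \<subseteq> {-int n..int n}"
  proof -
    define n where "n = nat (Max (insert 0 (abs ` A)))"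
    have "\<bar>k\<bar> \<le> int n" if "k \<in> A" for k
      unfolding n_def using assms that by (simp add: max_def)
    then have "A \<subseteq> {-int n..int n}" by (force simp: abs_le_iff)
    then show ?thesis using that by blast
  qed
  have "sum ?c A \<le> sum ?c {-int n..int n}"
    by (rule sum_mono2[OF _ n]) auto
  also have "\<dots> \<le> 1 / 2" using interval[of n] by (smt (verit) divide_nonneg_nonneg of_nat_0_le_iff)
  finally show ?thesis .
qed

lemma sum_prod_list_le:
  fixes c :: "'b \<Rightarrow> real"
  assumes c: "\<And>k. 0 \<le> c k" "\<And>A. finite A \<Longrightarrow> sum c A \<le> 1 / 2" and F: "finite F"
  shows "(\<Sum>s\<in>F. prod_list (map c s)) \<le> 2"
proof -
  let ?p = "\<lambda>s. prod_list (map c s)"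
  have p: "0 \<le> ?p s" for s by (induction s) (auto simp: c)
  define A where "A = (\<Union>s\<in>F. set s)"
  define L where "L n = {s. set s \<subseteq> A \<and> length s \<le> n}" for n
  have A: "finite A" using F by (simp add: A_def)
  have L: "finite (L n)" for n unfolding L_def by (rule finite_lists_length_le[OF A])
  have le: "sum ?p (L n) \<le> 2" for n
  proof (induction n)
    case 0
    have "L 0 = {[]}" by (auto simp: L_def)
    then show ?case by simp
  next
    case (Suc n)
    have "L (Suc n) = insert [] ((\<lambda>(a, s). a # s) ` (A \<times> L n))"
    proof (intro equalityI subsetI)
      fix s assume "s \<in> L (Suc n)"
      then show "s \<in> insert [] ((\<lambda>(a, s). a # s) ` (A \<times> L n))"
        by (cases s) (auto simp: L_def)
    qed (auto simp: L_def)
    then have "sum ?p (L (Suc n)) = sum ?p (insert [] ((\<lambda>(a, s). a # s) ` (A \<times> L n)))" by simp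
    also have "\<dots> = 1 + sum ?p ((\<lambda>(a, s). a # s) ` (A \<times> L n))"
      using A L by (subst sum.insert) auto
    also have "sum ?p ((\<lambda>(a, s). a # s) ` (A \<times> L n)) = (\<Sum>(a, s)\<in>A \<times> L n. c a * ?p s)"
      by (subst sum.reindex) (auto simp: inj_on_def case_prod_unfold)
    also have "\<dots> = sum c A * sum ?p (L n)"
      by (simp add: sum_product sum.cartesian_product)
    also have "1 + \<dots> \<le> 1 + 1 / 2 * 2"
      using c A Suc p by (intro add_left_mono mult_mono sum_nonneg) auto
    finally show ?case by simp
  qed
  have "F \<subseteq> L (Max (length ` F))"
    using F by (auto simp: L_def A_def)
  then have "sum ?p F \<le> sum ?p (L (Max (length ` F)))"
    using L p by (intro sum_mono2) auto
  also have "\<dots> \<le> 2" by (rule le)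
  finally show ?thesis .
qed

lemma inverse_power_le_prod_list:
  assumes "\<And>k. k \<in> set s \<Longrightarrow> 5 + \<bar>real_of_int k\<bar> \<le> f"
  shows "1 / f ^ (2 * length s) \<le> prod_list (map (\<lambda>k. 1 / (5 + real_of_int \<bar>k\<bar>)\<^sup>2) s)"
  using assms
proof (induction s)
  case (Cons a s)
  have f: "5 + \<bar>real_of_int a\<bar> \<le> f" using Cons.prems by simp
  then have "1 / f\<^sup>2 \<le> 1 / (5 + \<bar>real_of_int a\<bar>)\<^sup>2"
    by (intro divide_left_mono power_mono) auto
  moreover have "1 / f ^ (2 * length s) \<le> prod_list (map (\<lambda>k. 1 / (5 + real_of_int \<bar>k\<bar>)\<^sup>2) s)"
    using Cons by simp
  ultimately have "1 / f\<^sup>2 * (1 / f ^ (2 * length s))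
      \<le> 1 / (5 + \<bar>real_of_int a\<bar>)\<^sup>2 * prod_list (map (\<lambda>k. 1 / (5 + real_of_int \<bar>k\<bar>)\<^sup>2) s)"
    using f by (intro mult_mono) auto
  then show ?case by (simp add: power_add power2_eq_square)
qed simp

lemma weight_pos: "K \<ge> 5 \<Longrightarrow> weight K s > 0"
  using height_ge[of K s] by (simp add: weight_def)

lemma weight_summable:
  assumes "K \<ge> 5"
  shows "weight K summable_on UNIV"
proof (rule nonneg_bdd_above_summable_on)
  show "bdd_above (sum (weight K) ` {F. F \<subseteq> UNIV \<and> finite F})"
  proof (rule bdd_aboveI)
    fix x assume "x \<in> sum (weight K) ` {F. F \<subseteq> UNIV \<and> finite F}"
    then obtain F where F: "finite F" "x = sum (weight K) F" by blast
    have "x \<le> (\<Sum>s\<in>F. prod_list (map (\<lambda>k. 1 / (5 + real_of_int \<bar>k\<bar>)\<^sup>2) s))"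
      unfolding F weight_def using height_ge_entry[of K] assms
      by (intro sum_mono inverse_power_le_prod_list) fastforce
    also have "\<dots> \<le> 2" by (intro sum_prod_list_le F(1) sum_inverse_squares_le) auto
    finally show "x \<le> 2" .
  qed
qed (use weight_pos[OF assms] in \<open>auto intro: less_imp_le\<close>)

text \<open>Maps that change the sum of the absolute values of the first \<open>n\<close> entries by at most \<open>1\<close>,
for every \<open>n\<close>.\<close>

definition slow :: "((nat \<Rightarrow> int) \<Rightarrow> nat \<Rightarrow> int) \<Rightarrow> bool" where
  "slow h \<longleftrightarrow> (\<forall>n l. \<bar>(\<Sum>i<n. \<bar>h l i\<bar>) - (\<Sum>i<n. \<bar>l i\<bar>)\<bar> \<le> 1)"

lemma height_trunc_act:
  assumes "slow h"
  shows "\<bar>height K (trunc_act h s) - height K s\<bar> \<le> 1"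
proof -
  let ?n = "length s"
  have "\<bar>(\<Sum>i<?n. \<bar>h (pad s) i\<bar>) - (\<Sum>i<?n. \<bar>pad s i\<bar>)\<bar> \<le> 1"
    using assms by (simp add: slow_def)
  moreover have "(\<Sum>i<?n. \<bar>pad s i\<bar>) = (\<Sum>i<?n. \<bar>s ! i\<bar>)"
    by (intro sum.cong) (auto simp: pad_def)
  moreover have "(\<Sum>i<?n. \<bar>h (pad s) i\<bar>) = (\<Sum>i<?n. \<bar>trunc_act h s ! i\<bar>)"
    by (intro sum.cong) (auto simp: nth_trunc_act)
  ultimately have "\<bar>(\<Sum>i<?n. \<bar>trunc_act h s ! i\<bar>) - (\<Sum>i<?n. \<bar>s ! i\<bar>)\<bar> \<le> 1"
    by simp
  moreover have "height K (trunc_act h s) - height K s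
      = real_of_int ((\<Sum>i<?n. \<bar>trunc_act h s ! i\<bar>) - (\<Sum>i<?n. \<bar>s ! i\<bar>))"
    by (simp add: height_def)
  ultimately show ?thesis by (simp only: of_int_abs[symmetric] of_int_le_1_iff)
qed

lemma abs_ln_diff_le:
  fixes x y :: real
  assumes "5 \<le> x" "\<bar>y - x\<bar> \<le> 1"
  shows "\<bar>ln x - ln y\<bar> \<le> 2 / x"
proof -
  have y: "x / 2 \<le> y" "0 < y" using assms by linarith+
  have "ln x - ln y \<le> (x - y) / y" using assms y by (intro ln_diff_le) auto
  also have "\<dots> \<le> 1 / (x / 2)" using assms y by (intro frac_le) auto
  finally have 1: "ln x - ln y \<le> 2 / x" by simp
  have "ln y - ln x \<le> (y - x) / x" using assms y by (intro ln_diff_le) auto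
  also have "\<dots> \<le> 2 / x" using assms by (intro divide_right_mono) auto
  finally show ?thesis using 1 by simp
qed

lemma ln_weight_ratio:
  assumes "K \<ge> 5" "slow h"
  shows "\<bar>ln (weight K (trunc_act h s) / weight K s)\<bar> \<le> 4 * real (length s) / height K s"
proof -
  let ?n = "real (length s)" and ?f = "height K s" and ?g = "height K (trunc_act h s)"
  have f: "?f \<ge> 5" "?g \<ge> 5"
    using height_ge[of K s] height_ge[of K "trunc_act h s"] assms by auto
  have "weight K (trunc_act h s) / weight K s = (?f / ?g) ^ (2 * length s)"
    by (simp add: weight_def power_divide)
  then have "ln (weight K (trunc_act h s) / weight K s) = 2 * ?n * (ln ?f - ln ?g)"
    using f by (simp add: ln_realpow ln_div)
  then have "\<bar>ln (weight K (trunc_act h s) / weight K s)\<bar> = 2 * ?n * \<bar>ln ?f - ln ?g\<bar>"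
    by (simp add: abs_mult)
  also have "\<dots> \<le> 2 * ?n * (2 / ?f)"
    using f by (intro mult_left_mono abs_ln_diff_le height_trunc_act assms) auto
  finally show ?thesis by simp
qed

lemma length_over_height_le:
  assumes "K > 0"
  shows "4 * real (length s) / height K s \<le> 4 / K"
proof -
  have "real (length s) \<le> (real (length s) + 1)\<^sup>2"
    by (simp add: power2_eq_square algebra_simps)
  moreover have "K * (real (length s) + 1)\<^sup>2 > 0" using assms by simp
  ultimately have "4 * real (length s) / height K s
      \<le> 4 * (real (length s) + 1)\<^sup>2 / (K * (real (length s) + 1)\<^sup>2)"
    by (intro frac_le height_ge_square) auto
  also have "\<dots> = 4 / K" by simp
  finally show ?thesis .
qed

lemma length_over_height_tendsto_0:
  assumes K: "K \<ge> 5"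
  shows "((\<lambda>s. 4 * real (length s) / height K s) \<longlongrightarrow> 0) cofinite"
proof (rule tendstoI)
  fix e :: real assume e: "e > 0"
  define N where "N = 4 / (K * e)"
  define M where "M = 4 * N / e"
  let ?B = "{s. set s \<subseteq> {-\<lceil>M\<rceil>..\<lceil>M\<rceil>} \<and> length s \<le> nat \<lceil>N\<rceil>}"
  have in_B: "s \<in> ?B" if s: "e \<le> 4 * real (length s) / height K s" for s
  proof -
    have h: "height K s > 0" using height_ge[of K s] K by simp
    then have eh: "e * height K s \<le> 4 * real (length s)"
      using s by (simp add: pos_le_divide_eq)
    have "e * (K * (real (length s) + 1)\<^sup>2) \<le> 4 * real (length s)"
      using order_trans[OF mult_left_mono[OF height_ge_square] eh] e by simp
    also have "\<dots> \<le> 4 * (real (length s) + 1)" by simp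
    finally have "K * e * (real (length s) + 1) * (real (length s) + 1) \<le> 4 * (real (length s) + 1)"
      by (simp only: power2_eq_square mult.assoc mult.left_commute[of e K])
    then have "K * e * (real (length s) + 1) \<le> 4"
      by (rule mult_right_le_imp_le) simp
    moreover have Ke: "K * e > 0" using K e by simp
    ultimately have "K * e * real (length s) \<le> 4" by (simp only: distrib_left mult_1_right)
    then have n: "real (length s) \<le> N"
      using Ke by (simp add: N_def pos_le_divide_eq mult.commute)
    have "\<bar>k\<bar> \<le> \<lceil>M\<rceil>" if "k \<in> set s" for k
    proof -
      have "real_of_int \<bar>k\<bar> \<le> height K s" using height_ge_entry[OF _ that, of K] K by simp
      also have "\<dots> \<le> 4 * N / e" using eh n e by (simp add: field_simps)
      finally show ?thesis unfolding M_def by linarith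
    qed
    moreover have "length s \<le> nat \<lceil>N\<rceil>" using n by linarith
    ultimately show ?thesis by (force simp: abs_le_iff)
  qed
  have "dist (4 * real (length s) / height K s) 0 = 4 * real (length s) / height K s" for s
    using height_ge[of K s] K by simp
  then have "{s. \<not> dist (4 * real (length s) / height K s) 0 < e} \<subseteq> ?B"
    using in_B by (metis (no_types, lifting) linorder_not_less mem_Collect_eq subsetI)
  moreover have "finite ?B" by (rule finite_lists_length_le) simp
  ultimately show "\<forall>\<^sub>F s in cofinite. dist (4 * real (length s) / height K s) 0 < e"
    unfolding eventually_cofinite by (rule finite_subset)
qed

lemma abs_exp_minus_1_le:
  fixes z :: real
  assumes "\<bar>z\<bar> \<le> 1"
  shows "\<bar>exp z - 1\<bar> \<le> 2 * \<bar>z\<bar>"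
proof (cases "0 \<le> z")
  case True
  have "z\<^sup>2 \<le> z" using assms True by (simp add: power2_eq_square mult_left_le)
  then show ?thesis using exp_bound[of z] exp_ge_add_one_self[of z] True assms by auto
next
  case False
  then have "exp z \<le> 1" by simp
  then show ?thesis using exp_ge_add_one_self[of z] False by linarith
qed

lemma weighted_order_weight:
  assumes "K \<ge> 5"
  shows "weighted_order (\<lambda>s. weight K s / (\<Sum>\<^sub>\<infinity>s. weight K s))"
proof
  have has: "(weight K has_sum (\<Sum>\<^sub>\<infinity>s. weight K s)) UNIV"
    by (rule has_sum_infsum[OF weight_summable[OF assms]])
  have "sum (weight K) {[]} \<le> (\<Sum>\<^sub>\<infinity>s. weight K s)"
    by (rule finite_sum_le_has_sum[OF has]) (use weight_pos[OF assms] in \<open>auto intro: less_imp_le\<close>)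
  then have pos: "(\<Sum>\<^sub>\<infinity>s. weight K s) > 0"
    using weight_pos[OF assms, of "[]"] by simp
  then show "weight K s / (\<Sum>\<^sub>\<infinity>s. weight K s) > 0" for s
    using weight_pos[OF assms] by simp
  have "((\<lambda>s. weight K s * (1 / (\<Sum>\<^sub>\<infinity>s. weight K s))) has_sum
      (\<Sum>\<^sub>\<infinity>s. weight K s) * (1 / (\<Sum>\<^sub>\<infinity>s. weight K s))) UNIV"
    by (rule has_sum_cmult_left[OF has])
  then show "((\<lambda>s. weight K s / (\<Sum>\<^sub>\<infinity>s. weight K s)) has_sum 1) UNIV"
    using pos by simp
  show "infinite (UNIV :: int list set)" by (rule infinite_UNIV_listI)
qed

section \<open>The representation of the group\<close>

lemma group_H_induct [consumes 1, case_names id gen inverse comp]: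
  assumes "h \<in> carrier group_H"
    and id: "P (\<lambda>l. l)"
    and gen: "\<And>h. h \<in> {gen_a, gen_b, gen_c, gen_d} \<Longrightarrow> P h"
    and inverse: "\<And>h. h \<in> {gen_a, gen_b, gen_c, gen_d} \<Longrightarrow> P (inv_into UNIV h)"
    and comp: "\<And>h k. h \<in> carrier group_H \<Longrightarrow> k \<in> carrier group_H \<Longrightarrow> P h \<Longrightarrow> P k \<Longrightarrow> P (h \<circ> k)"
  shows "P h"
proof -
  have "bij h \<and> P h"
    using assms(1) unfolding carrier_group_H
  proof (induction rule: generate.induct)
    case one
    then show ?case using id by (simp add: BijGroup_def bij_id[unfolded id_def])
  next
    case (incl h)
    then show ?case using gen bij_gen by blast
  next
    case (inv h)
    then have "bij h" using bij_gen by blast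
    then show ?case
      using inverse[OF inv] bij_imp_bij_inv by (simp add: inv_BijGroup Bij_def)
  next
    case (eng h k)
    then have "h \<otimes>\<^bsub>BijGroup UNIV\<^esub> k = h \<circ> k"
      by (auto simp: BijGroup_def Bij_def compose_def)
    moreover have "bij (h \<circ> k)" "P (h \<circ> k)"
      using eng by (blast intro: bij_comp comp[unfolded carrier_group_H])+
    ultimately show ?case by metis
  qed
  then show ?thesis by blast
qed

lemma group_H_mult:
  assumes "h \<in> carrier group_H" "k \<in> carrier group_H"
  shows "h \<otimes>\<^bsub>group_H\<^esub> k = h \<circ> k"
proof -
  have "bij h" if "h \<in> carrier group_H" for h
    using that
  proof (induction rule: group_H_induct)
    case (gen h) then show ?case using bij_gen by blast
  next
    case (inverse h) then show ?case using bij_gen bij_imp_bij_inv by blast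
  next
    case (comp h k) then show ?case by (blast intro: bij_comp)
  qed (rule bij_id[unfolded id_def])
  from this[OF assms(1)] this[OF assms(2)] have "h \<in> Bij UNIV" "k \<in> Bij UNIV"
    by (simp_all add: Bij_def)
  then show ?thesis
    by (simp add: group_H_def subgroup_generated_def BijGroup_def compose_def fun_eq_iff)
qed

lemma tree_auto_group_H:
  assumes "h \<in> carrier group_H"
  shows "tree_auto h"
  using assms
proof (induction rule: group_H_induct)
  case (gen h) then show ?case using tree_auto_gens by blast
next
  case (inverse h) then show ?case using tree_auto_gens tree_auto_inv by blast
next
  case (comp h k) then show ?case by (blast intro: tree_auto_comp)
qed (rule tree_auto_id)

lemma slow_gens: "h \<in> {gen_a, gen_b, gen_c, gen_d} \<Longrightarrow> slow h"
  unfolding slow_def using gens_displacement by blast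

lemma deriv01_id:
  assumes "x \<in> {0..1}"
  shows "deriv01 (\<lambda>x\<in>{0..1}. x) x = 1"
proof -
  have "((\<lambda>x\<in>{0..1}. x) has_real_derivative 1) (at x within {0..1})"
    by (rule has_field_derivative_transform_within[OF DERIV_ident zero_less_one assms]) simp
  then show ?thesis
    unfolding deriv01_def using assms
    by (intro vector_derivative_within_closed_interval)
      (auto simp: has_real_derivative_iff_has_vector_derivative)
qed

theorem mainTheorem2:
  fixes V :: "(real \<Rightarrow> real) set"
  assumes "V \<subseteq> carrier Diff1"
    and "\<exists>U. openin C1_topology U \<and> (\<lambda>x\<in>{0..1}. x) \<in> U \<and> U \<subseteq> V"
  shows "\<exists>\<phi>. \<phi> \<in> hom group_H Diff1 \<and> inj_on \<phi> (carrier group_H) \<and>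
    \<phi> gen_a \<in> V \<and> \<phi> gen_b \<in> V \<and> \<phi> gen_c \<in> V \<and> \<phi> gen_d \<in> V"
proof -
  obtain U where U: "openin C1_topology U" "(\<lambda>x\<in>{0..1}. x) \<in> U" "U \<subseteq> V"
    using assms(2) by blast
  obtain \<epsilon> where \<epsilon>: "\<epsilon> > 0" "\<And>g. g \<in> Diff1_set \<Longrightarrow>
      (\<And>x. x \<in> {0..1} \<Longrightarrow> \<bar>g x - x\<bar> < \<epsilon> \<and> \<bar>deriv01 g x - 1\<bar> < \<epsilon>) \<Longrightarrow> g \<in> V"
  proof -
    obtain e where e: "e > 0" "\<forall>g\<in>Diff1_set. (\<forall>x\<in>{0..1}. \<bar>g x - (\<lambda>x\<in>{0..1}. x) x\<bar> < e \<and>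
        \<bar>deriv01 g x - deriv01 (\<lambda>x\<in>{0..1}. x) x\<bar> < e) \<longrightarrow> g \<in> U"
      using U(1,2) unfolding openin_C1_topology by blast
    show ?thesis
    proof (rule that[OF e(1)])
      fix g assume "g \<in> Diff1_set" "\<And>x. x \<in> {0..1} \<Longrightarrow> \<bar>g x - x\<bar> < e \<and> \<bar>deriv01 g x - 1\<bar> < e"
      then have "g \<in> U" using e(2) by (simp add: deriv01_id)
      then show "g \<in> V" using U(3) by blast
    qed
  qed
  \<comment> \<open>The logarithms of the length ratios of generators have absolute value at most \<open>4 / K\<close>,
    so the squares of the ratios differ from \<open>1\<close> by at most \<open>16 / K \<le> \<epsilon> / 2\<close>; the summand \<open>8\<close> is for the bound \<open>abs_exp_minus_1_le\<close>.\<close>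
  define K where "K = 8 + 32 / \<epsilon>"
  have K: "K \<ge> 5" "K \<ge> 8" "16 / K \<le> \<epsilon> / 2"
    using \<epsilon>(1) by (auto simp: K_def field_simps add_pos_pos)
  define len where "len s = weight K s / (\<Sum>\<^sub>\<infinity>s. weight K s)" for s
  interpret weighted_order len
    using weighted_order_weight[OF K(1)] by (simp add: len_def[abs_def])
  define ratio where "ratio h s = len (trunc_act h s) / len s" for h s
  have ratio_pos: "ratio h s > 0" for h s by (simp add: ratio_def len_pos)
  have ln_ratio: "\<bar>ln (ratio h s)\<bar> \<le> 4 * real (length s) / height K s" if "slow h" for h s
  proof -
    have "(\<Sum>\<^sub>\<infinity>s. weight K s) \<noteq> 0"
      using len_pos[of "[]"] by (auto simp: len_def)
    then have "ratio h s = weight K (trunc_act h s) / weight K s"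
      by (simp add: ratio_def len_def)
    then show ?thesis using ln_weight_ratio[OF K(1) that] by simp
  qed
  have tame_gen: "tame (trunc_act h)" if "slow h" for h
  proof -
    have "((\<lambda>s. ln (ratio h s)) \<longlongrightarrow> 0) cofinite"
      by (rule tendsto_rabs_zero_cancel, rule tendsto_sandwich[OF _ _ tendsto_const
            length_over_height_tendsto_0[OF K(1)]])
        (use ln_ratio[OF that] in auto)
    from tendsto_exp[OF this] show ?thesis
      by (simp add: tame_def ratio_pos) (simp add: ratio_def)
  qed
  have near: "\<bar>(ratio h s)\<^sup>2 - 1\<bar> \<le> \<epsilon> / 2" if "slow h" for h s
  proof -
    have "\<bar>ln (ratio h s)\<bar> \<le> 4 / K"
      using ln_ratio[OF that, of s] length_over_height_le[of K s] K by simp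
    then have z: "\<bar>2 * ln (ratio h s)\<bar> \<le> 8 / K" by simp
    also have "8 / K \<le> 1" using K by simp
    finally have "\<bar>exp (2 * ln (ratio h s)) - 1\<bar> \<le> 2 * \<bar>2 * ln (ratio h s)\<bar>"
      by (rule abs_exp_minus_1_le)
    also have "\<dots> \<le> \<epsilon> / 2" using z K(3) by simp
    finally show ?thesis by (simp add: exp_double ratio_pos)
  qed
  have act_order: "order_auto (trunc_act h)" if "tree_auto h" for h
    using that by (simp add: order_auto_def bij_trunc_act strict_mono_trunc_act)
  have tame: "tame (trunc_act h)" if "h \<in> carrier group_H" for h
    using that
  proof (induction rule: group_H_induct)
    case id
    have "trunc_act (\<lambda>l. l) = id" by (simp add: fun_eq_iff trunc_act_id)
    then show ?case using len_pos by (simp add: tame_def less_imp_neq[symmetric])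
  next
    case (gen h)
    then show ?case by (intro tame_gen slow_gens)
  next
    case (inverse h)
    then have h: "tree_auto h" using tree_auto_gens by blast
    have "trunc_act (inv_into UNIV h) = inv_into UNIV (trunc_act h)"
      using bij_trunc_act[OF h] trunc_act_inverse[OF h]
      by (metis bij_is_inj inv_f_f ext)
    then show ?case
      using tame_inv[OF tame_gen[OF slow_gens[OF inverse]] bij_trunc_act[OF h]] by simp
  next
    case (comp h k)
    then have t: "tree_auto h" "tree_auto k" using tree_auto_group_H by auto
    have "trunc_act (h \<circ> k) = trunc_act h \<circ> trunc_act k"
      using trunc_act_comp[OF t(1)] by (simp add: fun_eq_iff)
    then show ?case using tame_comp[OF comp.IH bij_trunc_act[OF t(2)]] by metis
  qed
  define \<phi> where "\<phi> h = diffeo (trunc_act h)" for h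
  have gens: "\<phi> h \<in> V" if h: "h \<in> {gen_a, gen_b, gen_c, gen_d}" for h
  proof (rule \<epsilon>(2))
    have *: "order_auto (trunc_act h)" "tame (trunc_act h)"
      using h tree_auto_gens by (auto intro: act_order tame_gen slow_gens)
    then show "\<phi> h \<in> Diff1_set" unfolding \<phi>_def by (rule diffeo_in_Diff1)
    fix x :: real assume x: "x \<in> {0..1}"
    have "\<bar>(len (trunc_act h s) / len s)\<^sup>2 - 1\<bar> \<le> \<epsilon> / 2" for s
      using near[OF slow_gens[OF h]] by (simp add: ratio_def)
    from diffeo_near_id[OF * this x]
    show "\<bar>\<phi> h x - x\<bar> < \<epsilon> \<and> \<bar>deriv01 (\<phi> h) x - 1\<bar> < \<epsilon>"
      using \<epsilon>(1) unfolding \<phi>_def by auto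
  qed
  have mem: "\<phi> h \<in> Diff1_set" if "h \<in> carrier group_H" for h
    unfolding \<phi>_def using that by (intro diffeo_in_Diff1 act_order tame tree_auto_group_H)
  have "\<phi> \<in> hom group_H Diff1"
  proof (rule homI)
    fix h assume "h \<in> carrier group_H"
    then show "\<phi> h \<in> carrier Diff1" using mem by (simp add: Diff1_def)
  next
    fix h k assume hk: "h \<in> carrier group_H" "k \<in> carrier group_H"
    have t: "tree_auto h" "tree_auto k" using hk tree_auto_group_H by auto
    have "trunc_act (h \<circ> k) = trunc_act h \<circ> trunc_act k"
      using trunc_act_comp[OF t(1)] by (simp add: fun_eq_iff)
    then have "\<phi> (h \<circ> k) = compose {0..1} (\<phi> h) (\<phi> k)"
      unfolding \<phi>_def by (simp only: diffeo_comp act_order t)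
    moreover have "\<phi> h \<in> Bij {0..1}" "\<phi> k \<in> Bij {0..1}"
      using mem hk by (auto simp: Diff1_set_def)
    ultimately show "\<phi> (h \<otimes>\<^bsub>group_H\<^esub> k) = \<phi> h \<otimes>\<^bsub>Diff1\<^esub> \<phi> k"
      using hk by (simp add: group_H_mult Diff1_def BijGroup_def)
  qed
  moreover have "inj_on \<phi> (carrier group_H)"
  proof (rule inj_onI)
    fix h k assume "h \<in> carrier group_H" "k \<in> carrier group_H" "\<phi> h = \<phi> k"
    then show "h = k"
      unfolding \<phi>_def using tree_auto_group_H act_order diffeo_inject trunc_act_inject by metis
  qed
  ultimately show ?thesis using gens by blast
qed

end
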